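(* Assume either $1<\alpha\le 3$ and $0<r_1<\infty$, or $\alpha>3$ and $r_1\in(0,\infty]$. Let $Y$ be a random compact subset of $\mathbb{R}^2$ such that $D(a_1)\subset Y\subset D(a_2)$ almost surely for some constants $0<a_1<a_2$, and for $r_0\in(0,r_1)$ let $\partial M(r_0,r_1)$ denote the random closed set consisting of the union of the boundaries of the visible parts in the dead leaves model $M(r_0,r_1)$. Then, as $r_0\to0$, $\partial M(r_0,r_1)$ converges to the deterministic set $\mathbb{R}^2$ in the sense of weak convergence of random closed sets.
   Context: $D(a)$ is the disk of radius $a$ centered at the origin; $\mathring A$ and $\partial A$ denote interior and topological boundary. The space $\mathcal{F}$ of closed subsets of $\mathbb{R}^2$ carries the Fell topology (generated by the sets $\{F:F\cap K=\emptyset\}$, $K$ compact, and $\{F:F\cap G\neq\emptyset\}$, $G$ open) and its Borel $\sigma$-field. A random closed set is a random element of $\mathcal{F}$ (random compact if a.s. compact); weak convergence of random closed sets is weak convergence of their laws on $\mathcal{F}$. Dead leaves model associated with a random closed set $X$: let $\{(x_i,t_i)\}$ be a homogeneous Poisson point process of intensity one on $\mathbb{R}^2\times\mathbb{R}$ and $(X_i)$ i.i.d. copies of $X$, independent of it. Using only points with $t_i\le 0$, the visible parts are $V_i=(x_i+X_i)\setminus\bigcup_{t_j\in(t_i,0)}(x_j+\mathring X_j)$, $t_i\le 0$; the model is $M=\{V_i\}$, and $\partial M=\bigcup_i\partial V_i$. $M(r_0,r_1)$ denotes the dead leaves model associated with $X=RY$, where $R$ is a real random variable independent of $Y$ with probability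 density proportional to $r^{-\alpha}\mathbf{1}(r_0\le r\le r_1)$. *)

theory Defs
  imports "HOL-Probability.Probability"
begin

definition fell_topology :: "'a::euclidean_space set topology" where
  "fell_topology = topology_generated_by
     ({{F. closed F \<and> F \<inter> K = {}} |K. compact K} \<union> {{F. closed F \<and> F \<inter> G \<noteq> {}} |G. open G})"

lemma topspace_fell_topology: "topspace fell_topology = {F. closed F}"
proof (rule subset_antisym)
  show "topspace fell_topology \<subseteq> {F::'a set. closed F}"
    unfolding fell_topology_def topology_generated_by_topspace
    by (rule Union_least) (elim UnE CollectE exE conjE, simp_all add: Collect_mono)
  have "{F::'a set. closed F} = {F. closed F \<and> F \<inter> {} = {}}" by simp
  then show "{F::'a set. closed F} \<subseteq> topspace fell_topology"
    unfolding fell_topology_def topology_generated_by_topspace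
    by (intro Union_upper UnI1 CollectI exI[of _ "{}"] conjI compact_empty)
qed

definition borel_of :: "'b topology \<Rightarrow> 'b measure" where
  "borel_of T = sigma (topspace T) {U. openin T U}"

definition random_closed_set :: "'w measure \<Rightarrow> ('w \<Rightarrow> 'a::euclidean_space set) \<Rightarrow> bool" where
  "random_closed_set P X \<longleftrightarrow> X \<in> P \<rightarrow>\<^sub>M borel_of fell_topology"

definition random_compact_set :: "'w measure \<Rightarrow> ('w \<Rightarrow> 'a::euclidean_space set) \<Rightarrow> bool" where
  "random_compact_set P X \<longleftrightarrow> random_closed_set P X \<and> (AE \<omega> in P. compact (X \<omega>))"

text \<open>The library's \<open>indep_var\<close> needs both variables to take values in the same type.\<close>

definition independent_rvs ::
  "'w measure \<Rightarrow> 'b measure \<Rightarrow> ('w \<Rightarrow> 'b) \<Rightarrow> 'c measure \<Rightarrow> ('w \<Rightarrow> 'c) \<Rightarrow> bool" where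
  "independent_rvs P S X T Y \<longleftrightarrow>
     X \<in> P \<rightarrow>\<^sub>M S \<and> Y \<in> P \<rightarrow>\<^sub>M T \<and>
     prob_space.indep_set P {X -` A \<inter> space P |A. A \<in> sets S} {Y -` B \<inter> space P |B. B \<in> sets T}"

definition weakly_converges ::
  "'b topology \<Rightarrow> ('i \<Rightarrow> 'b measure) \<Rightarrow> 'b measure \<Rightarrow> 'i filter \<Rightarrow> bool" where
  "weakly_converges T \<mu> \<nu> Fi \<longleftrightarrow>
     (\<forall>f. continuous_map T euclideanreal f \<and> bounded (f ` topspace T) \<longrightarrow>
       ((\<lambda>i. \<integral>s. f s \<partial>\<mu> i) \<longlongrightarrow> (\<integral>s. f s \<partial>\<nu>)) Fi)"

definition point_count :: "('i \<Rightarrow> 'w \<Rightarrow> 'b) \<Rightarrow> 'b set \<Rightarrow> 'w \<Rightarrow> nat" where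
  "point_count p A \<omega> = card {i. p i \<omega> \<in> A}"

text \<open>
  A homogeneous Poisson process of intensity one, given as a measurable enumeration of its points.
  The library's \<open>poisson_pmf\<close> is specified only for positive rates, so its weights are written
  out; the rate \<open>0\<close> then gives the point mass at \<open>0\<close>. Since \<open>card\<close> of an infinite set
  is \<open>0\<close>, local finiteness is required separately.
\<close>

definition unit_poisson_process ::
  "'w measure \<Rightarrow> (nat \<Rightarrow> 'w \<Rightarrow> 'b::euclidean_space) \<Rightarrow> bool" where
  "unit_poisson_process P p \<longleftrightarrow>
     (\<forall>i. p i \<in> borel_measurable P) \<and>
     (\<forall>A \<in> sets borel. emeasure lborel A < \<infinity> \<longrightarrow>
        (AE \<omega> in P. finite {i. p i \<omega> \<in> A}) \<and>
        (\<forall>k. measure P {\<omega> \<in> space P. point_count p A \<omega> = k} =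
               measure lborel A ^ k / fact k * exp (- measure lborel A))) \<and>
     (\<forall>(A :: nat \<Rightarrow> 'b set) n.
        (\<forall>k<n. A k \<in> sets borel \<and> emeasure lborel (A k) < \<infinity>) \<and>
        disjoint_family_on A {..<n} \<longrightarrow>
        prob_space.indep_vars P (\<lambda>_. count_space UNIV) (\<lambda>k. point_count p (A k)) {..<n})"

text \<open>
  Positions \<open>x\<close>, falling times \<open>t\<close> and leaves \<open>L\<close> on a probability space \<open>P\<close>;
  \<open>\<mu>\<close> is the common law of the leaves.
\<close>

definition dead_leaves_process ::
  "'w measure \<Rightarrow> 'a::euclidean_space set measure \<Rightarrow>
   (nat \<Rightarrow> 'w \<Rightarrow> 'a) \<Rightarrow> (nat \<Rightarrow> 'w \<Rightarrow> real) \<Rightarrow> (nat \<Rightarrow> 'w \<Rightarrow> 'a set) \<Rightarrow> bool" where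
  "dead_leaves_process P \<mu> x t L \<longleftrightarrow>
     prob_space P \<and>
     unit_poisson_process P (\<lambda>i \<omega>. (x i \<omega>, t i \<omega>)) \<and>
     (\<forall>i. random_closed_set P (L i) \<and> distr P (borel_of fell_topology) (L i) = \<mu>) \<and>
     prob_space.indep_vars P (\<lambda>_. borel_of fell_topology) L UNIV \<and>
     independent_rvs P
       (Pi\<^sub>M UNIV (\<lambda>_. borel)) (\<lambda>\<omega>. \<lambda>i\<in>UNIV. (x i \<omega>, t i \<omega>))
       (Pi\<^sub>M UNIV (\<lambda>_. borel_of fell_topology)) (\<lambda>\<omega>. \<lambda>i\<in>UNIV. L i \<omega>)"

definition visible_part ::
  "(nat \<Rightarrow> 'w \<Rightarrow> 'a::euclidean_space) \<Rightarrow> (nat \<Rightarrow> 'w \<Rightarrow> real) \<Rightarrow> (nat \<Rightarrow> 'w \<Rightarrow> 'a set) \<Rightarrow>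
   nat \<Rightarrow> 'w \<Rightarrow> 'a set" where
  "visible_part x t L i \<omega> =
     (+) (x i \<omega>) ` L i \<omega> -
     (\<Union>j \<in> {j. t j \<omega> \<in> {t i \<omega><..<0}}. (+) (x j \<omega>) ` interior (L j \<omega>))"

definition dead_leaves_model ::
  "(nat \<Rightarrow> 'w \<Rightarrow> 'a::euclidean_space) \<Rightarrow> (nat \<Rightarrow> 'w \<Rightarrow> real) \<Rightarrow> (nat \<Rightarrow> 'w \<Rightarrow> 'a set) \<Rightarrow>
   'w \<Rightarrow> 'a set set" where
  "dead_leaves_model x t L \<omega> = {visible_part x t L i \<omega> |i. t i \<omega> \<le> 0}"

definition dead_leaves_boundary ::
  "(nat \<Rightarrow> 'w \<Rightarrow> 'a::euclidean_space) \<Rightarrow> (nat \<Rightarrow> 'w \<Rightarrow> real) \<Rightarrow> (nat \<Rightarrow> 'w \<Rightarrow> 'a set) \<Rightarrow>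
   'w \<Rightarrow> 'a set" where
  "dead_leaves_boundary x t L \<omega> = (\<Union>V \<in> dead_leaves_model x t L \<omega>. frontier V)"

definition power_law_radius ::
  "'w measure \<Rightarrow> real \<Rightarrow> real \<Rightarrow> ereal \<Rightarrow> ('w \<Rightarrow> real) \<Rightarrow> bool" where
  "power_law_radius Q \<alpha> r0 r1 R \<longleftrightarrow>
     (\<exists>c>0. distributed Q lborel R
        (\<lambda>r. ennreal (c * r powr (- \<alpha>) * indicator {r. r0 \<le> r \<and> ereal r \<le> r1} r)))"

definition scaled_set :: "('w \<Rightarrow> real) \<Rightarrow> ('w \<Rightarrow> 'a::euclidean_space set) \<Rightarrow> 'w \<Rightarrow> 'a set" where
  "scaled_set R Y \<omega> = (*\<^sub>R) (R \<omega>) ` Y \<omega>"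

end

theory Submission
  imports Defs
begin

text \<open>
  A ball \<open>G\<close> can be missed by the boundary \<open>\<partial>M\<close> only if, up to null sets, one leaf contains \<open>G\<close> while
  being the topmost leaf over the points of \<open>G\<close>: as \<open>G\<close> is connected, a visible part that meets \<open>G\<close>
  without containing it has a boundary point in \<open>G\<close>. When \<open>r\<^sub>0\<close> is small, almost all leaves are
  small, and the topmost leaf over a given point is very unlikely to be a large one.

  To make this quantitative, fix a time horizon \<open>T\<close> and call a leaf large if it reaches farther than
  \<open>\<rho>/2\<close> from its centre, where \<open>\<rho>\<close> is the radius of \<open>G\<close>. If some leaf has its centre in \<open>G\<close> and falls
  during \<open>(-T, 0)\<close>, and no large leaf falling in that time meets \<open>G\<close>, then the topmost leaf over that
  centre is small, and its visible part meets \<open>G\<close> without containing it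
  (\<open>dead_leaves_boundary_hits_ball\<close>). So the probability that \<open>\<partial>M\<close> misses \<open>G\<close> is at most the
  probability \<open>exp (- T |G|)\<close> that no centre falls in \<open>G\<close>, plus the expected number of large leaves
  near \<open>G\<close> (\<open>dead_leaves_boundary_miss_probability\<close>). No conditioning on the first leaf that hits
  \<open>G\<close> is involved, so only first moments of the marked Poisson process enter.

  In dimension \<open>d\<close> that expected number is at most \<open>T\<close> times a constant times the moment
  \<open>E [R\<^sup>d; R \<ge> \<delta>]\<close> (\<open>near_large_intensity\<close>), which for a power law is at most \<open>c(r\<^sub>0)\<close> times the
  integral of \<open>r\<^sup>d\<^sup>-\<^sup>\<alpha>\<close> over \<open>[\<delta>, r\<^sub>1]\<close>. The integral is finite if \<open>r\<^sub>1 < \<infinity>\<close> or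
  \<open>\<alpha> > d + 1\<close>, and the normalising constant \<open>c(r\<^sub>0)\<close> is of order at most \<open>r\<^sub>0\<^sup>\<alpha>\<^sup>-\<^sup>1\<close>
  (\<open>power_law_constant_le\<close>), hence tends to \<open>0\<close> as \<open>\<alpha> > 1\<close>. Choosing first \<open>T\<close> large and then \<open>r\<^sub>0\<close>
  small makes both terms small. Since every Fell neighbourhood of the whole space contains all closed sets
  that hit finitely many given open sets, this is enough for weak convergence
  (\<open>weakly_converges_to_UNIV\<close>).

  It remains to see that \<open>\<partial>M\<close> is, up to a null set, a random closed set. Almost surely, every leaf contains a
  ball of a fixed radius around its centre, so by compactness any bounded region is completely covered by
  the leaves of a finite time span; and only finitely many of these meet it, again by the first moment. Hence the
  boundaries of the visible parts form a locally finite family of closed sets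
  (\<open>closed_dead_leaves_boundary\<close>). Measurability follows from the fact that visible parts and
  frontiers are obtained by removing interiors of random closed sets from random closed sets, an
  operation that preserves measurability (\<open>random_closed_set_minus_interiors\<close>).
\<close>

section \<open>Measurability with respect to the Fell topology\<close>

definition hit_miss_cell :: "'a::euclidean_space set set \<Rightarrow> 'a set set \<Rightarrow> 'a set set" where
  "hit_miss_cell D E = {F. closed F \<and> (\<forall>b\<in>D. F \<inter> b = {}) \<and> (\<forall>b\<in>E. F \<inter> b \<noteq> {})}"

text \<open>
  By compactness, a closed set that misses \<open>K\<close> misses a finite union of basic open sets that covers \<open>K\<close>.
  For a countable base \<open>\<B>\<close> there are only countably many cells, so Fell open sets become countable unions
  of them. A cell need not be Fell open, since missing an open set is not an open condition; for
  measurability this does no harm.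
\<close>

lemma fell_open_contains_cell:
  fixes U :: "'a::euclidean_space set set"
  assumes basis: "topological_basis \<B>" and U: "openin fell_topology U" and F: "F \<in> U"
  obtains D E where "finite D" "D \<subseteq> \<B>" "finite E" "E \<subseteq> \<B>"
    "F \<in> hit_miss_cell D E" "hit_miss_cell D E \<subseteq> U"
proof -
  let ?S = "{{F::'a set. closed F \<and> F \<inter> K = {}} |K. compact K} \<union> {{F. closed F \<and> F \<inter> G \<noteq> {}} |G. open G}"
  have "generate_topology_on ?S U"
    using U by (simp add: fell_topology_def openin_topology_generated_by_iff)
  then have "\<forall>F\<in>U. \<exists>D E. finite D \<and> D \<subseteq> \<B> \<and> finite E \<and> E \<subseteq> \<B> \<and>
      F \<in> hit_miss_cell D E \<and> hit_miss_cell D E \<subseteq> U"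
  proof induction
    case Empty
    then show ?case by simp
  next
    case (Int a b)
    show ?case
    proof
      fix F assume "F \<in> a \<inter> b"
      then have "F \<in> a" "F \<in> b" by auto
      from bspec[OF Int.IH(1) this(1)] bspec[OF Int.IH(2) this(2)]
      obtain D E D' E' where *: "finite D" "D \<subseteq> \<B>" "finite E" "E \<subseteq> \<B>"
          "F \<in> hit_miss_cell D E" "hit_miss_cell D E \<subseteq> a"
          "finite D'" "D' \<subseteq> \<B>" "finite E'" "E' \<subseteq> \<B>"
          "F \<in> hit_miss_cell D' E'" "hit_miss_cell D' E' \<subseteq> b"
        by (elim exE conjE) (rule that)
      have "hit_miss_cell (D \<union> D') (E \<union> E') = hit_miss_cell D E \<inter> hit_miss_cell D' E'"
        by (auto simp: hit_miss_cell_def)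
      with * show "\<exists>D E. finite D \<and> D \<subseteq> \<B> \<and> finite E \<and> E \<subseteq> \<B> \<and>
          F \<in> hit_miss_cell D E \<and> hit_miss_cell D E \<subseteq> a \<inter> b"
        by (intro exI[of _ "D \<union> D'"] exI[of _ "E \<union> E'"]) auto
    qed
  next
    case (UN K)
    show ?case
    proof
      fix F assume "F \<in> \<Union>K"
      then obtain k where k: "k \<in> K" "F \<in> k" by blast
      from bspec[OF UN.IH[OF k(1)] k(2)] obtain D E where
          "finite D" "D \<subseteq> \<B>" "finite E" "E \<subseteq> \<B>"
          "F \<in> hit_miss_cell D E" "hit_miss_cell D E \<subseteq> k"
        by (elim exE conjE) (rule that)
      with k(1) show "\<exists>D E. finite D \<and> D \<subseteq> \<B> \<and> finite E \<and> E \<subseteq> \<B> \<and>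
          F \<in> hit_miss_cell D E \<and> hit_miss_cell D E \<subseteq> \<Union>K"
        by (intro exI[of _ D] exI[of _ E]) auto
    qed
  next
    case (Basis s)
    show ?case
    proof
      fix F assume F: "F \<in> s"
      from Basis consider (miss) K where "compact K" "s = {F. closed F \<and> F \<inter> K = {}}"
        | (hit) G where "open G" "s = {F. closed F \<and> F \<inter> G \<noteq> {}}" by blast
      then show "\<exists>D E. finite D \<and> D \<subseteq> \<B> \<and> finite E \<and> E \<subseteq> \<B> \<and>
          F \<in> hit_miss_cell D E \<and> hit_miss_cell D E \<subseteq> s"
      proof cases
        case miss
        have "open (- F)" "K \<subseteq> - F" using F miss by auto
        define C where "C = {b\<in>\<B>. b \<subseteq> - F}"
        have "K \<subseteq> \<Union>C"
        proof
          fix y assume "y \<in> K"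
          then obtain b where "b \<in> \<B>" "y \<in> b" "b \<subseteq> - F"
            using topological_basisE[OF basis \<open>open (- F)\<close>] \<open>K \<subseteq> - F\<close> by (metis subsetD)
          then show "y \<in> \<Union>C" unfolding C_def by auto
        qed
        moreover have "\<And>b. b \<in> C \<Longrightarrow> open b"
          using basis by (auto simp: C_def topological_basis_open)
        ultimately obtain D where D: "D \<subseteq> C" "finite D" "K \<subseteq> \<Union>D"
          using compactE[OF \<open>compact K\<close>, of C] by blast
        have "F \<in> hit_miss_cell D {}" using D F miss by (auto simp: hit_miss_cell_def C_def)
        moreover have "hit_miss_cell D {} \<subseteq> s" using D miss by (auto simp: hit_miss_cell_def)
        moreover have "D \<subseteq> \<B>" using D by (auto simp: C_def)
        ultimately show ?thesis using D(2) by blast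
      next
        case hit
        then obtain y where y: "y \<in> F" "y \<in> G" using F by auto
        obtain b where b: "b \<in> \<B>" "y \<in> b" "b \<subseteq> G"
          using topological_basisE[OF basis \<open>open G\<close> y(2)] by blast
        have "F \<in> hit_miss_cell {} {b}" using b y F hit by (auto simp: hit_miss_cell_def)
        moreover have "hit_miss_cell {} {b} \<subseteq> s" using b hit by (auto simp: hit_miss_cell_def)
        ultimately show ?thesis using b(1) by (intro exI[of _ "{}"] exI[of _ "{b}"]) auto
      qed
    qed
  qed
  with F show ?thesis using that by blast
qed

lemma space_borel_of_fell: "space (borel_of fell_topology) = {F. closed F}"
  using openin_subset[of fell_topology]
  by (subst topspace_fell_topology[symmetric]) (auto simp: borel_of_def intro!: space_measure_of)

lemma fell_open_in_borel: "openin fell_topology U \<Longrightarrow> U \<in> sets (borel_of fell_topology)"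
  by (auto simp: borel_of_def intro!: sigma_sets.Basic dest: openin_subset)

lemma openin_fell_hit: "open G \<Longrightarrow> openin fell_topology {F::'a::euclidean_space set. closed F \<and> F \<inter> G \<noteq> {}}"
  unfolding fell_topology_def by (rule topology_generated_by_Basis) blast

lemma openin_fell_miss: "compact K \<Longrightarrow> openin fell_topology {F::'a::euclidean_space set. closed F \<and> F \<inter> K = {}}"
  unfolding fell_topology_def by (rule topology_generated_by_Basis) blast

text \<open>
  Every Fell open set is a union of cells over a countable base, hence a countable union, so it suffices
  to test the events of hitting an open set.
\<close>

lemma random_closed_setI:
  fixes X :: "'w \<Rightarrow> 'a::euclidean_space set"
  assumes closed: "\<And>\<omega>. \<omega> \<in> space P \<Longrightarrow> closed (X \<omega>)"
    and hits: "\<And>G. open G \<Longrightarrow> {\<omega> \<in> space P. X \<omega> \<inter> G \<noteq> {}} \<in> sets P"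
  shows "random_closed_set P X"
  unfolding random_closed_set_def borel_of_def
proof (rule measurable_measure_of)
  show "{U::'a set set. openin fell_topology U} \<subseteq> Pow (topspace fell_topology)"
    by (auto dest: openin_subset)
  show "X \<in> space P \<rightarrow> topspace fell_topology"
    using closed by (auto simp: topspace_fell_topology)
next
  fix U :: "'a set set" assume "U \<in> {U. openin fell_topology U}"
  then have U: "openin fell_topology U" by simp
  obtain \<B> :: "'a set set" where \<B>: "countable \<B>" "topological_basis \<B>"
    using ex_countable_basis by blast
  define I where "I = {(D, E). finite D \<and> D \<subseteq> \<B> \<and> finite E \<and> E \<subseteq> \<B> \<and> hit_miss_cell D E \<subseteq> U}"
  have "I \<subseteq> {D. finite D \<and> D \<subseteq> \<B>} \<times> {D. finite D \<and> D \<subseteq> \<B>}" by (auto simp: I_def)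
  then have "countable I"
    by (rule countable_subset) (intro countable_SIGMA countable_Collect_finite_subset \<B>)
  have eq: "X -` U \<inter> space P = (\<Union>(D, E)\<in>I. {\<omega>\<in>space P. X \<omega> \<in> hit_miss_cell D E})" (is "?l = ?r")
  proof
    show "?l \<subseteq> ?r"
    proof
      fix \<omega> assume "\<omega> \<in> ?l"
      then have "X \<omega> \<in> U" "\<omega> \<in> space P" by auto
      obtain D E where "(D, E) \<in> I" "X \<omega> \<in> hit_miss_cell D E"
        by (rule fell_open_contains_cell[OF \<B>(2) U \<open>X \<omega> \<in> U\<close>]) (auto simp: I_def)
      with \<open>\<omega> \<in> space P\<close> show "\<omega> \<in> ?r" by auto
    qed
  qed (auto simp: I_def)
  have open_\<B>: "open b" if "b \<in> \<B>" for b using \<B>(2) that by (rule topological_basis_open)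
  have "{\<omega>\<in>space P. X \<omega> \<in> hit_miss_cell D E} \<in> sets P"
    if "finite D" "D \<subseteq> \<B>" "finite E" "E \<subseteq> \<B>" for D E
  proof -
    have "{\<omega>\<in>space P. X \<omega> \<in> hit_miss_cell D E} =
        {\<omega>\<in>space P. (\<forall>b\<in>D. \<not> X \<omega> \<inter> b \<noteq> {}) \<and> (\<forall>b\<in>E. X \<omega> \<inter> b \<noteq> {})}"
      using closed by (auto simp: hit_miss_cell_def)
    also have "\<dots> \<in> sets P"
      using that
      by (intro sets.sets_Collect_conj sets.sets_Collect_finite_All sets.sets_Collect_neg hits open_\<B>)
        blast+
    finally show ?thesis .
  qed
  then show "X -` U \<inter> space P \<in> sets P"
    unfolding eq using \<open>countable I\<close> by (intro sets.countable_UN') (auto simp: I_def)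
qed

lemma random_closed_setI_compact:
  fixes X :: "'w \<Rightarrow> 'a::euclidean_space set"
  assumes closed: "\<And>\<omega>. \<omega> \<in> space P \<Longrightarrow> closed (X \<omega>)"
    and misses: "\<And>K. compact K \<Longrightarrow> {\<omega> \<in> space P. X \<omega> \<inter> K = {}} \<in> sets P"
  shows "random_closed_set P X"
proof (rule random_closed_setI[OF closed])
  fix G :: "'a set" assume "open G"
  then obtain K :: "nat \<Rightarrow> 'a set" where K: "\<And>n. compact (K n)" "\<Union>(range K) = G"
    using open_Union_compact_subsets by metis
  have "{\<omega> \<in> space P. X \<omega> \<inter> G \<noteq> {}} = {\<omega> \<in> space P. \<exists>n. \<not> X \<omega> \<inter> K n = {}}"
    using K(2) by blast
  also have "\<dots> \<in> sets P"
    using K misses by (intro sets.sets_Collect_countable_Ex sets.sets_Collect_neg) auto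
  finally show "{\<omega> \<in> space P. X \<omega> \<inter> G \<noteq> {}} \<in> sets P" .
qed

lemma random_closed_set_closed:
  "random_closed_set P X \<Longrightarrow> \<omega> \<in> space P \<Longrightarrow> closed (X \<omega>)"
  using measurable_space[of X P "borel_of fell_topology" \<omega>]
  by (simp add: random_closed_set_def space_borel_of_fell)

lemma random_closed_set_hits:
  assumes "random_closed_set P X" "open G"
  shows "{\<omega> \<in> space P. X \<omega> \<inter> G \<noteq> {}} \<in> sets P"
proof -
  have "X -` {F. closed F \<and> F \<inter> G \<noteq> {}} \<inter> space P \<in> sets P"
    using assms by (intro measurable_sets[OF _ fell_open_in_borel[OF openin_fell_hit]])
      (auto simp: random_closed_set_def)
  also have "X -` {F. closed F \<and> F \<inter> G \<noteq> {}} \<inter> space P = {\<omega> \<in> space P. X \<omega> \<inter> G \<noteq> {}}"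
    using random_closed_set_closed[OF assms(1)] by auto
  finally show ?thesis .
qed

lemma random_closed_set_contains:
  assumes "random_closed_set P X"
  shows "{\<omega> \<in> space P. y \<in> X \<omega>} \<in> sets P"
proof -
  have "X -` {F. closed F \<and> F \<inter> {y} = {}} \<inter> space P \<in> sets P"
    using assms by (intro measurable_sets[OF _ fell_open_in_borel[OF openin_fell_miss]])
      (auto simp: random_closed_set_def)
  also have "X -` {F. closed F \<and> F \<inter> {y} = {}} \<inter> space P = {\<omega> \<in> space P. \<not> y \<in> X \<omega>}"
    using random_closed_set_closed[OF assms(1)] by auto
  finally have "{\<omega> \<in> space P. \<not> \<not> y \<in> X \<omega>} \<in> sets P" by (rule sets.sets_Collect_neg)
  then show ?thesis by simp
qed

lemma random_closed_set_supset_open: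
  fixes X :: "'w \<Rightarrow> 'a::euclidean_space set"
  assumes X: "random_closed_set P X" and "open b"
  shows "{\<omega> \<in> space P. b \<subseteq> X \<omega>} \<in> sets P"
proof -
  obtain D :: "'a set" where D: "countable D" "\<And>X. open X \<Longrightarrow> X \<noteq> {} \<Longrightarrow> \<exists>d\<in>D. d \<in> X"
    by (rule countable_dense_setE) blast
  have "b \<subseteq> F \<longleftrightarrow> (\<forall>q\<in>D. q \<in> b \<longrightarrow> q \<in> F)" if "closed F" for F
    using D(2)[of "b - F"] open_Diff[OF \<open>open b\<close> that] by blast
  then have "{\<omega> \<in> space P. b \<subseteq> X \<omega>} = {\<omega> \<in> space P. \<forall>q\<in>D. q \<in> b \<longrightarrow> q \<in> X \<omega>}"
    using random_closed_set_closed[OF X] by blast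
  also have "\<dots> \<in> sets P"
    using D(1) random_closed_set_contains[OF X]
    by (intro sets.sets_Collect_countable_All' sets.sets_Collect_imp) auto
  finally show ?thesis .
qed

section \<open>Operations on random closed sets\<close>

text \<open>
  Hitting \<open>G\<close> after the random map means that the pair of the parameter and the set hits the open set
  \<open>f -` G\<close>, which is a countable union of open rectangles. Random translations and random scalings are
  the two cases needed below.
\<close>

lemma random_closed_set_image:
  fixes f :: "'b::second_countable_topology \<times> 'a::euclidean_space \<Rightarrow> 'c::euclidean_space"
  assumes cont: "continuous_on UNIV f" and h: "h \<in> borel_measurable P"
    and X: "random_closed_set P X"
    and closed: "\<And>\<omega>. \<omega> \<in> space P \<Longrightarrow> closed ((\<lambda>y. f (h \<omega>, y)) ` X \<omega>)"
  shows "random_closed_set P (\<lambda>\<omega>. (\<lambda>y. f (h \<omega>, y)) ` X \<omega>)"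
proof (rule random_closed_setI[OF closed])
  fix G :: "'c set" assume "open G"
  obtain \<A> :: "'b set set" where \<A>: "countable \<A>" "topological_basis \<A>"
    using ex_countable_basis by blast
  obtain \<B> :: "'a set set" where \<B>: "countable \<B>" "topological_basis \<B>"
    using ex_countable_basis by blast
  define I where "I = {(a, b). a \<in> \<A> \<and> b \<in> \<B> \<and> a \<times> b \<subseteq> f -` G}"
  have "I \<subseteq> \<A> \<times> \<B>" by (auto simp: I_def)
  then have "countable I" by (rule countable_subset) (intro countable_SIGMA \<A> \<B>)
  have op: "open (f -` G)" using cont \<open>open G\<close> by (simp add: continuous_on_open_vimage)
  have rect: "\<exists>i\<in>I. u \<in> fst i \<and> v \<in> snd i" if "f (u, v) \<in> G" for u v
  proof -
    have "(u, v) \<in> f -` G" using that by simp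
    then obtain A B where AB: "open A" "open B" "(u, v) \<in> A \<times> B" "A \<times> B \<subseteq> f -` G"
      using open_prod_elim[OF op] by metis
    then have "u \<in> A" "v \<in> B" by auto
    obtain a where "a \<in> \<A>" "u \<in> a" "a \<subseteq> A"
      using topological_basisE[OF \<A>(2) AB(1) \<open>u \<in> A\<close>] by blast
    moreover obtain b where "b \<in> \<B>" "v \<in> b" "b \<subseteq> B"
      using topological_basisE[OF \<B>(2) AB(2) \<open>v \<in> B\<close>] by blast
    moreover note AB
    ultimately have "(a, b) \<in> I" by (auto simp: I_def)
    then show ?thesis using \<open>u \<in> a\<close> \<open>v \<in> b\<close> by (intro bexI[of _ "(a, b)"]) auto
  qed
  have "{\<omega> \<in> space P. (\<lambda>y. f (h \<omega>, y)) ` X \<omega> \<inter> G \<noteq> {}} =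
      {\<omega> \<in> space P. \<exists>i\<in>I. h \<omega> \<in> fst i \<and> X \<omega> \<inter> snd i \<noteq> {}}" (is "?l = ?r")
  proof
    show "?l \<subseteq> ?r"
    proof
      fix \<omega> assume "\<omega> \<in> ?l"
      then obtain y where "\<omega> \<in> space P" "y \<in> X \<omega>" "f (h \<omega>, y) \<in> G" by blast
      with rect[of "h \<omega>" y] show "\<omega> \<in> ?r" by blast
    qed
    show "?r \<subseteq> ?l"
    proof
      fix \<omega> assume "\<omega> \<in> ?r"
      then obtain a b y where "(a, b) \<in> I" "h \<omega> \<in> a" "\<omega> \<in> space P" "y \<in> X \<omega>" "y \<in> b"
        by auto
      then have "f (h \<omega>, y) \<in> G" by (auto simp: I_def)
      with \<open>y \<in> X \<omega>\<close> \<open>\<omega> \<in> space P\<close> show "\<omega> \<in> ?l" by blast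
    qed
  qed
  also have "\<dots> \<in> sets P"
  proof (intro sets.sets_Collect_countable_Ex' sets.sets_Collect_conj \<open>countable I\<close>)
    fix i assume "i \<in> I"
    then have o: "open (fst i)" "open (snd i)"
      using \<A>(2) \<B>(2) by (auto simp: I_def topological_basis_open)
    have "h -` fst i \<inter> space P \<in> sets P" using h o(1) by (simp add: measurable_sets)
    then show "{\<omega> \<in> space P. h \<omega> \<in> fst i} \<in> sets P" by (simp add: vimage_def Int_def conj_commute)
    show "{\<omega> \<in> space P. X \<omega> \<inter> snd i \<noteq> {}} \<in> sets P" by (rule random_closed_set_hits[OF X o(2)])
  qed
  finally show "{\<omega> \<in> space P. (\<lambda>y. f (h \<omega>, y)) ` X \<omega> \<inter> G \<noteq> {}} \<in> sets P" .
qed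

lemma random_closed_set_translation:
  assumes "h \<in> borel_measurable P" "random_closed_set P X"
  shows "random_closed_set P (\<lambda>\<omega>. (+) (h \<omega>) ` X \<omega>)"
  using random_closed_set_image[of "\<lambda>(u, y). u + y" h P X] assms
    random_closed_set_closed[OF assms(2)]
  by (simp add: case_prod_unfold continuous_intros closed_translation)

lemma random_closed_set_scaling:
  assumes "h \<in> borel_measurable P" "random_closed_set P X"
  shows "random_closed_set P (scaled_set h X)"
  using random_closed_set_image[of "\<lambda>(u, y). u *\<^sub>R y" h P X] assms
    random_closed_set_closed[OF assms(2)]
  by (simp add: case_prod_unfold continuous_intros closed_scaling scaled_set_def[abs_def])

text \<open>
  The set in question misses a compact \<open>K\<close> iff \<open>K\<close> has a finite cover by basic open sets each of which
  misses \<open>C\<close> or lies inside one of the removed sets; both conditions are events, and there are only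
  countably many finite covers. This turns an existential statement over uncountably many points of
  \<open>K\<close> into a countable one.
\<close>

lemma random_closed_set_minus_interiors:
  fixes C :: "'w \<Rightarrow> 'a::euclidean_space set" and Z :: "nat \<Rightarrow> 'w \<Rightarrow> 'a set"
  assumes C: "random_closed_set P C" and Z: "\<And>j. random_closed_set P (Z j)"
    and J: "\<And>j. {\<omega> \<in> space P. J j \<omega>} \<in> sets P"
  shows "random_closed_set P (\<lambda>\<omega>. C \<omega> - (\<Union>j\<in>{j. J j \<omega>}. interior (Z j \<omega>)))"
proof (rule random_closed_setI_compact)
  fix \<omega> assume "\<omega> \<in> space P"
  then show "closed (C \<omega> - (\<Union>j\<in>{j. J j \<omega>}. interior (Z j \<omega>)))"
    using random_closed_set_closed[OF C] by (intro closed_Diff) auto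
next
  fix K :: "'a set" assume K: "compact K"
  obtain \<B> :: "'a set set" where \<B>: "countable \<B>" "topological_basis \<B>"
    using ex_countable_basis by blast
  have open_\<B>: "open b" if "b \<in> \<B>" for b using \<B>(2) that by (rule topological_basis_open)
  define \<D> where "\<D> = {D. finite D \<and> D \<subseteq> \<B> \<and> K \<subseteq> \<Union>D}"
  have "countable \<D>"
    by (rule countable_subset[OF _ countable_Collect_finite_subset[OF \<B>(1)]]) (auto simp: \<D>_def)
  define good where "good b \<omega> \<longleftrightarrow> \<not> C \<omega> \<inter> b \<noteq> {} \<or> (\<exists>j. J j \<omega> \<and> b \<subseteq> Z j \<omega>)" for b \<omega>
  have eq: "(C \<omega> - (\<Union>j\<in>{j. J j \<omega>}. interior (Z j \<omega>))) \<inter> K = {} \<longleftrightarrow> (\<exists>D\<in>\<D>. \<forall>b\<in>D. good b \<omega>)"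
    (is "?V \<inter> K = {} \<longleftrightarrow> _") if \<omega>: "\<omega> \<in> space P" for \<omega>
  proof
    assume miss: "?V \<inter> K = {}"
    have "\<exists>b\<in>\<B>. y \<in> b \<and> good b \<omega>" if "y \<in> K" for y
    proof (cases "y \<in> C \<omega>")
      case False
      then have "open (- C \<omega>)" "y \<in> - C \<omega>" using random_closed_set_closed[OF C \<omega>] by auto
      then obtain b where "b \<in> \<B>" "y \<in> b" "b \<subseteq> - C \<omega>"
        by (rule topological_basisE[OF \<B>(2)])
      then show ?thesis by (auto simp: good_def)
    next
      case True
      then obtain j where j: "J j \<omega>" "y \<in> interior (Z j \<omega>)" using miss \<open>y \<in> K\<close> by auto
      then obtain b where "b \<in> \<B>" "y \<in> b" "b \<subseteq> interior (Z j \<omega>)"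
        using topological_basisE[OF \<B>(2) open_interior j(2)] by blast
      moreover from \<open>b \<subseteq> interior (Z j \<omega>)\<close> have "b \<subseteq> Z j \<omega>"
        using interior_subset by (rule order_trans)
      ultimately show ?thesis unfolding good_def using j(1) by blast
    qed
    then have "K \<subseteq> \<Union>{b\<in>\<B>. good b \<omega>}" by blast
    then obtain D where "D \<subseteq> {b\<in>\<B>. good b \<omega>}" "finite D" "K \<subseteq> \<Union>D"
      by (rule compactE[OF K]) (use open_\<B> in blast)
    then show "\<exists>D\<in>\<D>. \<forall>b\<in>D. good b \<omega>" by (intro bexI[of _ D]) (auto simp: \<D>_def)
  next
    assume "\<exists>D\<in>\<D>. \<forall>b\<in>D. good b \<omega>"
    then obtain D where D: "D \<subseteq> \<B>" "K \<subseteq> \<Union>D" "\<And>b. b \<in> D \<Longrightarrow> good b \<omega>" by (auto simp: \<D>_def)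
    have "?V \<inter> b = {}" if "b \<in> D" for b
    proof -
      have "b \<subseteq> interior (Z j \<omega>)" if "b \<subseteq> Z j \<omega>" for j
        using that open_\<B>[of b] D(1) \<open>b \<in> D\<close> by (intro interior_maximal) auto
      then show ?thesis using D(3)[OF that] by (auto simp: good_def)
    qed
    then show "?V \<inter> K = {}" using D(2) by blast
  qed
  have "{\<omega> \<in> space P. good b \<omega>} \<in> sets P" if "b \<in> \<B>" for b
    unfolding good_def
    by (intro sets.sets_Collect_disj sets.sets_Collect_countable_Ex sets.sets_Collect_conj J
        sets.sets_Collect_neg random_closed_set_hits[OF C] random_closed_set_supset_open[OF Z]
        open_\<B> that)
  then have "{\<omega> \<in> space P. \<exists>D\<in>\<D>. \<forall>b\<in>D. good b \<omega>} \<in> sets P"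
    by (intro sets.sets_Collect_countable_Ex' sets.sets_Collect_finite_All \<open>countable \<D>\<close>)
      (auto simp: \<D>_def)
  also have "{\<omega> \<in> space P. \<exists>D\<in>\<D>. \<forall>b\<in>D. good b \<omega>} =
      {\<omega> \<in> space P. (C \<omega> - (\<Union>j\<in>{j. J j \<omega>}. interior (Z j \<omega>))) \<inter> K = {}}"
    using eq by blast
  finally show "{\<omega> \<in> space P. (C \<omega> - (\<Union>j\<in>{j. J j \<omega>}. interior (Z j \<omega>))) \<inter> K = {}} \<in> sets P" .
qed

text \<open>The frontier of a closed set arises by removing the interior of the set from itself.\<close>

lemma random_closed_set_frontier:
  assumes V: "random_closed_set P V"
  shows "random_closed_set P (\<lambda>\<omega>. frontier (V \<omega>))"
proof -
  have "random_closed_set P (\<lambda>\<omega>. V \<omega> - (\<Union>j\<in>{j::nat. True}. interior (V \<omega>)))"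
    by (rule random_closed_set_minus_interiors[OF V V]) auto
  also have "(\<lambda>\<omega>. V \<omega> - (\<Union>j\<in>{j::nat. True}. interior (V \<omega>))) = (\<lambda>\<omega>. V \<omega> - interior (V \<omega>))"
    by auto
  finally have "V' \<in> P \<rightarrow>\<^sub>M borel_of fell_topology" if "V' = (\<lambda>\<omega>. V \<omega> - interior (V \<omega>))" for V'
    using that by (simp add: random_closed_set_def)
  then show ?thesis
    unfolding random_closed_set_def
    by (subst measurable_cong[where g = "\<lambda>\<omega>. V \<omega> - interior (V \<omega>)"])
      (auto simp: frontier_def closure_closed random_closed_set_closed[OF V])
qed

section \<open>Weak convergence to the whole space\<close>

lemma continuous_map_fell_measurable:
  assumes "continuous_map fell_topology euclideanreal f"
  shows "f \<in> borel_measurable (borel_of fell_topology)"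
proof (rule borel_measurableI)
  fix S :: "real set" assume "open S"
  then have "openin fell_topology {F \<in> topspace fell_topology. f F \<in> S}"
    using openin_continuous_map_preimage[OF assms] by simp
  moreover have "{F \<in> topspace fell_topology. f F \<in> S} = f -` S \<inter> space (borel_of fell_topology)"
    by (auto simp: topspace_fell_topology space_borel_of_fell)
  ultimately show "f -` S \<inter> space (borel_of fell_topology) \<in> sets (borel_of fell_topology)"
    using fell_open_in_borel by metis
qed

text \<open>
  The whole space misses only the empty set, so a cell around it imposes only hitting conditions.
\<close>

lemma fell_neighbourhood_of_UNIV:
  fixes U :: "'a::euclidean_space set set"
  assumes "openin fell_topology U" "UNIV \<in> U"
  obtains E where "finite E" "\<And>b. b \<in> E \<Longrightarrow> open b \<and> b \<noteq> {}"
    "\<And>F. closed F \<Longrightarrow> (\<And>b. b \<in> E \<Longrightarrow> F \<inter> b \<noteq> {}) \<Longrightarrow> F \<in> U"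
proof -
  obtain \<B> :: "'a set set" where \<B>: "topological_basis \<B>" using ex_countable_basis by blast
  obtain D E where *: "finite E" "E \<subseteq> \<B>" "UNIV \<in> hit_miss_cell D E" "hit_miss_cell D E \<subseteq> U"
    by (rule fell_open_contains_cell[OF \<B> assms])
  show ?thesis
  proof (rule that[of E])
    show "finite E" by fact
    show "open b \<and> b \<noteq> {}" if "b \<in> E" for b
      using * that topological_basis_open[OF \<B>] by (auto simp: hit_miss_cell_def)
    show "F \<in> U" if "closed F" "\<And>b. b \<in> E \<Longrightarrow> F \<inter> b \<noteq> {}" for F
    proof -
      have "b = {}" if "b \<in> D" for b using *(3) that by (auto simp: hit_miss_cell_def)
      then have "F \<in> hit_miss_cell D E" using that by (auto simp: hit_miss_cell_def)
      with *(4) show ?thesis by blast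
    qed
  qed
qed

text \<open>
  A continuous test function is close to its value at the whole space as soon as finitely many open sets
  are hit, and it is bounded on the complementary event, whose probability vanishes in the limit.
\<close>

lemma weakly_converges_to_UNIV:
  fixes B :: "'i \<Rightarrow> 'w \<Rightarrow> 'a::euclidean_space set"
  assumes P: "\<forall>\<^sub>F r in Fi. prob_space (P r) \<and> random_closed_set (P r) (B r)"
    and miss: "\<And>G. open G \<Longrightarrow> G \<noteq> {} \<Longrightarrow>
      ((\<lambda>r. measure (P r) {\<omega> \<in> space (P r). B r \<omega> \<inter> G = {}}) \<longlongrightarrow> 0) Fi"
  shows "weakly_converges fell_topology (\<lambda>r. distr (P r) (borel_of fell_topology) (B r))
    (return (borel_of fell_topology) UNIV) Fi"
  unfolding weakly_converges_def
proof (intro allI impI, elim conjE)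
  fix f :: "'a set \<Rightarrow> real"
  assume cont: "continuous_map fell_topology euclideanreal f"
    and bdd: "bounded (f ` topspace fell_topology)"
  note f_meas = continuous_map_fell_measurable[OF cont]
  obtain M where M: "\<And>F. closed F \<Longrightarrow> \<bar>f F\<bar> \<le> M"
    using bdd by (auto simp: bounded_iff topspace_fell_topology)
  have "M \<ge> 0" using M[of "{}"] by force
  show "((\<lambda>i. \<integral>s. f s \<partial>distr (P i) (borel_of fell_topology) (B i)) \<longlongrightarrow>
      (\<integral>s. f s \<partial>return (borel_of fell_topology) UNIV)) Fi"
  proof (rule tendstoI)
    fix e :: real assume "e > 0"
    define U where "U = {F \<in> topspace fell_topology. f F \<in> ball (f UNIV) (e/2)}"
    have "openin fell_topology U" unfolding U_def
      by (rule openin_continuous_map_preimage[OF cont]) simp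
    moreover have "UNIV \<in> U" using \<open>e > 0\<close> by (simp add: U_def topspace_fell_topology)
    ultimately obtain E where E: "finite E" "\<And>b. b \<in> E \<Longrightarrow> open b \<and> b \<noteq> {}"
      "\<And>F. closed F \<Longrightarrow> (\<And>b. b \<in> E \<Longrightarrow> F \<inter> b \<noteq> {}) \<Longrightarrow> F \<in> U"
      using fell_neighbourhood_of_UNIV by metis
    define m where "m r b = measure (P r) {\<omega> \<in> space (P r). B r \<omega> \<inter> b = {}}" for r b
    have "((\<lambda>r. 2 * M * (\<Sum>b\<in>E. m r b)) \<longlongrightarrow> 2 * M * (\<Sum>b\<in>E. 0)) Fi"
      using E(2) miss unfolding m_def by (intro tendsto_intros) auto
    then have "\<forall>\<^sub>F r in Fi. 2 * M * (\<Sum>b\<in>E. m r b) < e/2"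
      using \<open>e > 0\<close> by (intro order_tendstoD(2)) auto
    with P show "\<forall>\<^sub>F r in Fi. dist (\<integral>s. f s \<partial>distr (P r) (borel_of fell_topology) (B r))
        (\<integral>s. f s \<partial>return (borel_of fell_topology) UNIV) < e"
    proof eventually_elim
      case (elim r)
      then interpret prob_space "P r" by simp
      have B: "random_closed_set (P r) (B r)" using elim by simp
      have B_meas: "B r \<in> P r \<rightarrow>\<^sub>M borel_of fell_topology" using B by (simp add: random_closed_set_def)
      have clo: "closed (B r \<omega>)" if "\<omega> \<in> space (P r)" for \<omega>
        using random_closed_set_closed[OF B that] .
      have int: "integrable (P r) (\<lambda>\<omega>. f (B r \<omega>))"
        using measurable_compose[OF B_meas f_meas] M clo by (intro integrable_const_bound[of _ M]) auto
      have miss_meas: "{\<omega> \<in> space (P r). B r \<omega> \<inter> b = {}} \<in> events" if "b \<in> E" for b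
      proof -
        have "{\<omega> \<in> space (P r). \<not> B r \<omega> \<inter> b \<noteq> {}} \<in> events"
          using E(2)[OF that] by (intro sets.sets_Collect_neg random_closed_set_hits[OF B]) auto
        then show ?thesis by simp
      qed
      let ?I = "\<lambda>b. indicator {\<omega> \<in> space (P r). B r \<omega> \<inter> b = {}} :: 'w \<Rightarrow> real"
      have "\<bar>expectation (\<lambda>\<omega>. f (B r \<omega>)) - f UNIV\<bar> = \<bar>expectation (\<lambda>\<omega>. f (B r \<omega>) - f UNIV)\<bar>"
        using int by (simp add: prob_space)
      also have "\<dots> \<le> expectation (\<lambda>\<omega>. \<bar>f (B r \<omega>) - f UNIV\<bar>)"
        by (rule integral_abs_bound)
      also have "\<dots> \<le> expectation (\<lambda>\<omega>. e/2 + 2 * M * (\<Sum>b\<in>E. ?I b \<omega>))"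
      proof (rule integral_mono)
        show "integrable (P r) (\<lambda>\<omega>. \<bar>f (B r \<omega>) - f UNIV\<bar>)" using int by simp
        show "integrable (P r) (\<lambda>\<omega>. e/2 + 2 * M * (\<Sum>b\<in>E. ?I b \<omega>))"
          using miss_meas by (intro Bochner_Integration.integrable_add integrable_mult_right
              Bochner_Integration.integrable_sum integrable_const integrable_real_indicator)
            (auto simp: emeasure_eq_measure)
      next
        fix \<omega> assume \<omega>: "\<omega> \<in> space (P r)"
        show "\<bar>f (B r \<omega>) - f UNIV\<bar> \<le> e/2 + 2 * M * (\<Sum>b\<in>E. ?I b \<omega>)"
        proof (cases "\<forall>b\<in>E. B r \<omega> \<inter> b \<noteq> {}")
          case True
          then have "B r \<omega> \<in> U" using E(3) clo[OF \<omega>] by blast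
          then have "\<bar>f (B r \<omega>) - f UNIV\<bar> \<le> e/2" by (simp add: U_def dist_real_def abs_minus_commute)
          moreover have "0 \<le> 2 * M * (\<Sum>b\<in>E. ?I b \<omega>)" using \<open>M \<ge> 0\<close> by (intro mult_nonneg_nonneg sum_nonneg) auto
          ultimately show ?thesis by linarith
        next
          case False
          then obtain b where b: "b \<in> E" "B r \<omega> \<inter> b = {}" by blast
          have "1 \<le> ?I b \<omega>" using b \<omega> by simp
          also have "\<dots> \<le> (\<Sum>b\<in>E. ?I b \<omega>)" using b E(1) by (intro member_le_sum) auto
          finally have "2 * M * 1 \<le> 2 * M * (\<Sum>b\<in>E. ?I b \<omega>)"
            using \<open>M \<ge> 0\<close> by (intro mult_left_mono) auto
          then show ?thesis using M[OF clo[OF \<omega>]] M[of UNIV] \<open>e > 0\<close> by simp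
        qed
      qed
      also have "\<dots> = e/2 + 2 * M * (\<Sum>b\<in>E. m r b)"
      proof -
        have "integrable (P r) (?I b)" if "b \<in> E" for b
          using miss_meas[OF that] by (auto simp: emeasure_eq_measure)
        moreover have "expectation (?I b) = m r b" if "b \<in> E" for b
          using miss_meas[OF that] by (simp add: m_def Int_absorb1 sets.sets_into_space)
        ultimately show ?thesis
          by (subst Bochner_Integration.integral_add) (auto simp: prob_space)
      qed
      also have "\<dots> < e" using elim by simp
      finally have "\<bar>expectation (\<lambda>\<omega>. f (B r \<omega>)) - f UNIV\<bar> < e" .
      then show ?case
        using f_meas B_meas
        by (simp add: integral_distr integral_return space_borel_of_fell dist_real_def)
    qed
  qed
qed

section \<open>Geometry of a single realisation\<close>

lemma visible_part_subset_leaf: "visible_part x t L i \<omega> \<subseteq> (+) (x i \<omega>) ` L i \<omega>"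
  by (auto simp: visible_part_def)

lemma closed_visible_part:
  assumes "closed (L i \<omega>)"
  shows "closed (visible_part x t L i \<omega>)"
  unfolding visible_part_def using assms
  by (intro closed_Diff closed_translation open_UN ballI open_translation open_interior)

lemma dead_leaves_boundary_eq:
  "dead_leaves_boundary x t L \<omega> = (\<Union>i\<in>{i. t i \<omega> \<le> 0}. frontier (visible_part x t L i \<omega>))"
  by (auto simp: dead_leaves_boundary_def dead_leaves_model_def)

lemma mem_translated_interior:
  fixes a y :: "'a::euclidean_space"
  assumes "ball 0 r \<subseteq> A" "dist a y < r"
  shows "y \<in> (+) a ` interior A"
proof -
  have "y - a \<in> ball 0 r" using assms(2) by (simp add: dist_norm norm_minus_commute)
  then have "y - a \<in> interior A" using interior_maximal[OF assms(1) open_ball] by blast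
  then show ?thesis by (intro image_eqI[of _ _ "y - a"]) auto
qed

text \<open>
  Every point of a ball around the origin is within \<open>\<epsilon>\<close> of one of finitely many points of \<open>D\<close>. A leaf
  with centre within \<open>\<epsilon>\<close> of such a point covers, with its interior, all points that are \<open>\<epsilon>\<close>-close to
  it. After these finitely many leaves, going back in time, nothing more is visible in the ball, so only
  finitely many visible parts contribute there.
\<close>

lemma closed_dead_leaves_boundary:
  fixes x :: "nat \<Rightarrow> 'w \<Rightarrow> 'a::euclidean_space"
  assumes closed: "\<And>i. closed (L i \<omega>)" and core: "\<And>i. ball 0 (2 * \<epsilon>) \<subseteq> L i \<omega>"
    and dense: "\<And>y. \<exists>d\<in>D. dist d y < \<epsilon>"
    and rain: "\<And>d. d \<in> D \<Longrightarrow> \<exists>i. dist (x i \<omega>) d < \<epsilon> \<and> t i \<omega> < 0"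
    and fin: "\<And>N T::nat. finite {i. t i \<omega> \<in> {- real T..0} \<and> (+) (x i \<omega>) ` L i \<omega> \<inter> cball 0 (real N) \<noteq> {}}"
  shows "closed (dead_leaves_boundary x t L \<omega>)"
proof -
  let ?V = "\<lambda>i. visible_part x t L i \<omega>"
  let ?S = "dead_leaves_boundary x t L \<omega>"
  have "closure ?S \<subseteq> ?S"
  proof
    fix z assume z: "z \<in> closure ?S"
    obtain N :: nat where N: "norm z < real N" using reals_Archimedean2 by blast
    obtain D' where D': "D' \<subseteq> D" "finite D'" "cball 0 (real N) \<subseteq> (\<Union>d\<in>D'. ball d \<epsilon>)"
    proof (rule compactE_image[of "cball (0::'a) (real N)" D "\<lambda>d. ball d \<epsilon>"])
      show "cball 0 (real N) \<subseteq> (\<Union>d\<in>D. ball d \<epsilon>)" using dense by auto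
    qed auto
    obtain i where i: "\<And>d. d \<in> D' \<Longrightarrow> dist (x (i d) \<omega>) d < \<epsilon> \<and> t (i d) \<omega> < 0"
      using rain D'(1) by (meson subsetD)
    obtain T :: nat where T: "\<And>d. d \<in> D' \<Longrightarrow> - t (i d) \<omega> < real T"
    proof -
      obtain T :: nat where "Max (insert 0 ((\<lambda>d. - t (i d) \<omega>) ` D')) < real T"
        using reals_Archimedean2 by blast
      then show ?thesis using D'(2) that[of T] by auto
    qed
    define I where "I = {i. t i \<omega> \<in> {- real T..0} \<and> (+) (x i \<omega>) ` L i \<omega> \<inter> cball 0 (real N) \<noteq> {}}"
    have late: "j \<in> I" if j: "t j \<omega> \<le> 0" "y \<in> ?V j" "y \<in> cball 0 (real N)" for j y
    proof -
      obtain d where d: "d \<in> D'" "dist d y < \<epsilon>" using D'(3) j(3) by auto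
      have "dist (x (i d) \<omega>) y < 2 * \<epsilon>"
        using i[OF d(1)] d(2) dist_triangle[of "x (i d) \<omega>" y d] by linarith
      then have "y \<in> (+) (x (i d) \<omega>) ` interior (L (i d) \<omega>)" by (rule mem_translated_interior[OF core])
      moreover have "y \<notin> (+) (x k \<omega>) ` interior (L k \<omega>)" if "t k \<omega> \<in> {t j \<omega><..<0}" for k
        using j(2) that unfolding visible_part_def by blast
      ultimately have "t j \<omega> \<ge> t (i d) \<omega>" using i[OF d(1)] by force
      then show ?thesis using T[OF d(1)] j visible_part_subset_leaf[of x t L j \<omega>] by (auto simp: I_def)
    qed
    have front: "frontier (?V j) \<subseteq> ?V j" for j
      using closed_visible_part[of L j \<omega>, OF closed[of j]] by (rule frontier_subset_closed)
    have "ball 0 (real N) \<inter> ?S \<subseteq> (\<Union>j\<in>I. frontier (?V j))"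
      using late front by (fastforce simp: dead_leaves_boundary_eq)
    moreover have "closed (\<Union>j\<in>I. frontier (?V j))"
      using fin by (intro closed_UN) (auto simp: I_def)
    moreover have "z \<in> closure (ball 0 (real N) \<inter> ?S)"
      using open_Int_closure_subset[of "ball 0 (real N)" ?S] z N by auto
    ultimately have "z \<in> (\<Union>j\<in>I. frontier (?V j))" using closure_minimal by blast
    then show "z \<in> ?S" by (auto simp: dead_leaves_boundary_eq I_def)
  qed
  then show ?thesis by (simp add: closure_subset_eq)
qed

text \<open>
  The topmost leaf over the centre \<open>x i \<omega>\<close> exists by local finiteness and leaves that point visible. It
  meets the ball, hence is small, hence cannot contain the ball; connectedness of the ball produces a
  boundary point.
\<close>

lemma dead_leaves_boundary_hits_ball:
  fixes x :: "nat \<Rightarrow> 'w \<Rightarrow> 'a::euclidean_space"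
  assumes "0 < \<rho>" "0 < \<epsilon>"
    and core: "\<And>i. ball 0 \<epsilon> \<subseteq> L i \<omega>"
    and fin: "\<And>N T::nat. finite {i. t i \<omega> \<in> {- real T..0} \<and> (+) (x i \<omega>) ` L i \<omega> \<inter> cball 0 (real N) \<noteq> {}}"
    and i: "dist (x i \<omega>) c < \<rho>" "t i \<omega> \<in> {- T<..<0}"
    and small: "\<And>j. t j \<omega> \<in> {- T<..<0} \<Longrightarrow> (+) (x j \<omega>) ` L j \<omega> \<inter> ball c \<rho> \<noteq> {} \<Longrightarrow>
      L j \<omega> \<subseteq> cball 0 (\<rho> / 2)"
  shows "dead_leaves_boundary x t L \<omega> \<inter> ball c \<rho> \<noteq> {}"
proof -
  define y where "y = x i \<omega>"
  have y: "y \<in> ball c \<rho>" using i(1) by (simp add: y_def dist_commute)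
  define J where "J = {j. t j \<omega> \<in> {- T<..<0} \<and> y \<in> (+) (x j \<omega>) ` interior (L j \<omega>)}"
  have "i \<in> J" using i(2) mem_translated_interior[OF core[of i], of y y] \<open>0 < \<epsilon>\<close>
    by (auto simp: J_def y_def)
  obtain N :: nat where N: "norm y \<le> real N" using real_arch_simple by blast
  obtain T' :: nat where T': "T \<le> real T'" using real_arch_simple by blast
  have "J \<subseteq> {i. t i \<omega> \<in> {- real T'..0} \<and> (+) (x i \<omega>) ` L i \<omega> \<inter> cball 0 (real N) \<noteq> {}}"
  proof
    fix j assume "j \<in> J"
    then have "y \<in> (+) (x j \<omega>) ` L j \<omega>" "t j \<omega> \<in> {- T<..<0}"
      using interior_subset by (auto simp: J_def)
    then show "j \<in> {i. t i \<omega> \<in> {- real T'..0} \<and> (+) (x i \<omega>) ` L i \<omega> \<inter> cball 0 (real N) \<noteq> {}}"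
      using N T' by (auto simp del: Int_iff simp: disjoint_iff)
  qed
  then have "finite J" using fin finite_subset by blast
  have "Max ((\<lambda>k. t k \<omega>) ` J) \<in> (\<lambda>k. t k \<omega>) ` J"
    using \<open>finite J\<close> \<open>i \<in> J\<close> by (intro Max_in) auto
  \<comment> \<open>leaves may share the same time; any leaf with maximal time leaves \<open>y\<close> visible\<close>
  then obtain j where "j \<in> J" "t j \<omega> = Max ((\<lambda>k. t k \<omega>) ` J)" by auto
  then have j: "j \<in> J" "\<And>k. k \<in> J \<Longrightarrow> t k \<omega> \<le> t j \<omega>"
    using \<open>finite J\<close> by auto
  let ?V = "visible_part x t L j \<omega>"
  have yj: "y \<in> (+) (x j \<omega>) ` L j \<omega>" "t j \<omega> \<in> {- T<..<0}"
    using j(1) interior_subset by (auto simp: J_def)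
  have "y \<notin> (+) (x k \<omega>) ` interior (L k \<omega>)" if "t k \<omega> \<in> {t j \<omega><..<0}" for k
  proof
    assume "y \<in> (+) (x k \<omega>) ` interior (L k \<omega>)"
    then have "k \<in> J" using that yj(2) by (simp add: J_def)
    with j(2)[of k] that show False by simp
  qed
  then have "y \<in> ?V" using yj(1) unfolding visible_part_def by blast
  have "?V \<subseteq> cball (x j \<omega>) (\<rho> / 2)"
  proof
    fix z assume "z \<in> ?V"
    then have "z \<in> (+) (x j \<omega>) ` L j \<omega>" using visible_part_subset_leaf[of x t L j \<omega>] by (rule subsetD[rotated])
    then obtain l where "z = x j \<omega> + l" "l \<in> L j \<omega>" by auto
    moreover have "L j \<omega> \<subseteq> cball 0 (\<rho> / 2)" using small[OF yj(2)] yj(1) y by blast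
    ultimately show "z \<in> cball (x j \<omega>) (\<rho> / 2)" by (auto simp: dist_norm)
  qed
  moreover have "\<not> ball c \<rho> \<subseteq> cball (x j \<omega>) (\<rho> / 2)"
    using \<open>0 < \<rho>\<close> zero_le_dist[of c "x j \<omega>"]
    by (auto simp: ball_subset_cball_iff simp del: zero_le_dist)
  ultimately have "\<not> ball c \<rho> \<subseteq> ?V" by blast
  then have "ball c \<rho> \<inter> frontier ?V \<noteq> {}"
    using y \<open>y \<in> ?V\<close> by (intro connected_Int_frontier) auto
  moreover have "frontier ?V \<subseteq> dead_leaves_boundary x t L \<omega>"
    unfolding dead_leaves_boundary_eq using yj(2) by (intro UN_upper) auto
  ultimately show ?thesis by blast
qed

section \<open>Measurability of the boundary\<close>

text \<open>
  The boundary is closed only almost surely, and the exceptional event need not be measurable, so the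
  set is replaced by the empty set on a null set that contains this event.
\<close>

lemma random_closed_set_dead_leaves_boundary:
  fixes x :: "nat \<Rightarrow> 'w \<Rightarrow> 'a::euclidean_space"
  assumes x: "\<And>i. x i \<in> borel_measurable P" and t: "\<And>i. t i \<in> borel_measurable P"
    and L: "\<And>i. random_closed_set P (L i)"
    and closed: "AE \<omega> in P. closed (dead_leaves_boundary x t L \<omega>)"
  obtains B where "random_closed_set P B" "AE \<omega> in P. B \<omega> = dead_leaves_boundary x t L \<omega>"
proof -
  have leaf: "random_closed_set P (\<lambda>\<omega>. (+) (x i \<omega>) ` L i \<omega>)" for i
    using x L by (rule random_closed_set_translation)
  have V: "random_closed_set P (visible_part x t L i)" for i
  proof -
    have "random_closed_set P (\<lambda>\<omega>. (+) (x i \<omega>) ` L i \<omega> -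
        (\<Union>j\<in>{j. t j \<omega> \<in> {t i \<omega><..<0}}. interior ((+) (x j \<omega>) ` L j \<omega>)))"
      using leaf leaf
    proof (rule random_closed_set_minus_interiors)
      have [measurable]: "t j \<in> borel_measurable P" for j by (rule t)
      show "{\<omega> \<in> space P. t j \<omega> \<in> {t i \<omega><..<0}} \<in> sets P" for j
        unfolding greaterThanLessThan_iff by measurable
    qed
    then show ?thesis by (simp add: visible_part_def[abs_def] interior_translation)
  qed
  obtain N where N: "N \<in> null_sets P" "{\<omega> \<in> space P. \<not> closed (dead_leaves_boundary x t L \<omega>)} \<subseteq> N"
    using closed by (auto simp: eventually_ae_filter)
  define B where "B \<omega> = (if \<omega> \<in> N then {} else dead_leaves_boundary x t L \<omega>)" for \<omega>
  have "random_closed_set P B"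
  proof (rule random_closed_setI)
    show "closed (B \<omega>)" if "\<omega> \<in> space P" for \<omega> using N(2) that by (auto simp: B_def)
    fix G :: "'a set" assume "open G"
    have [measurable]: "t j \<in> borel_measurable P" for j by (rule t)
    have "{\<omega> \<in> space P. B \<omega> \<inter> G \<noteq> {}} =
        {\<omega> \<in> space P. \<exists>i. t i \<omega> \<le> 0 \<and> frontier (visible_part x t L i \<omega>) \<inter> G \<noteq> {}} - N"
      by (auto simp: B_def dead_leaves_boundary_eq)
    also have "\<dots> \<in> sets P"
      using N(1) \<open>open G\<close>
      by (intro sets.Diff sets.sets_Collect_countable_Ex sets.sets_Collect_conj
          random_closed_set_hits[OF random_closed_set_frontier[OF V]]) auto
    finally show "{\<omega> \<in> space P. B \<omega> \<inter> G \<noteq> {}} \<in> sets P" .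
  qed
  moreover have "AE \<omega> in P. B \<omega> = dead_leaves_boundary x t L \<omega>"
    using AE_not_in[OF N(1)] by eventually_elim (simp add: B_def)
  ultimately show ?thesis by (rule that)
qed

section \<open>Intensity of a marked Poisson process\<close>

lemma suminf_indicator_eq_card:
  fixes S :: "nat set"
  assumes "finite S"
  shows "(\<Sum>i. indicator S i :: ennreal) = of_nat (card S)"
proof -
  have "(\<Sum>i. indicator S i :: ennreal) = (\<Sum>i\<in>S. indicator S i)"
    by (rule suminf_finite[OF assms]) auto
  then show ?thesis using assms by (simp add: indicator_def)
qed

lemma suminf_poisson_mean:
  fixes m :: real
  assumes "0 \<le> m"
  shows "(\<Sum>k. of_nat k * ennreal (m ^ k / fact k * exp (- m))) = ennreal m"
proof -
  let ?f = "\<lambda>k. real k * (m ^ k / fact k * exp (- m))"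
  have "?f (Suc n) = (m * exp (- m)) * (m ^ n / fact n)" for n
    unfolding fact_Suc by (simp add: divide_simps del: of_nat_Suc)
  moreover have "(\<lambda>n. (m * exp (- m)) * (m ^ n / fact n)) sums (m * exp (- m) * exp m)"
    using exp_converges[of m] by (intro sums_mult) (simp add: field_simps)
  moreover have "m * exp (- m) * exp m = m" by (simp add: exp_minus)
  ultimately have "(\<lambda>n. ?f (Suc n)) sums m" by (simp only:)
  from sums_Suc[OF this] have "?f sums m" by simp
  then have "(\<Sum>k. ennreal (?f k)) = ennreal m"
    using assms by (subst suminf_ennreal2) (auto simp: sums_iff)
  moreover have "ennreal (?f k) = of_nat k * ennreal (m ^ k / fact k * exp (- m))" for k
    using assms by (subst ennreal_mult) (auto simp: ennreal_of_nat_eq_real_of_nat)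
  ultimately show ?thesis by simp
qed

lemma poisson_point_count_measurable:
  assumes "prob_space P" "unit_poisson_process P p" "A \<in> sets borel" "emeasure lborel A < \<infinity>"
  shows "point_count p A \<in> P \<rightarrow>\<^sub>M count_space UNIV"
proof -
  interpret prob_space P by fact
  have "indep_vars (\<lambda>_. count_space UNIV) (\<lambda>k. point_count p A) {..<1::nat}"
    using assms unfolding unit_poisson_process_def
    by (elim conjE allE[of _ "\<lambda>_. A"] allE[of _ 1]) (auto simp: disjoint_family_on_def)
  then show ?thesis by (auto simp: indep_vars_def2)
qed

text \<open>
  Campbell's formula for indicators: both sides are the mean number of points in \<open>A\<close>. The numbers of
  points are expanded over their possible values in order to use the Poisson weights.
\<close>

lemma poisson_intensity:
  assumes P: "prob_space P" and p: "unit_poisson_process P p"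
    and A: "A \<in> sets borel" "emeasure lborel A < \<infinity>"
  shows "(\<Sum>i. emeasure P {\<omega> \<in> space P. p i \<omega> \<in> A}) = emeasure lborel A"
proof -
  interpret prob_space P by fact
  have [measurable]: "p i \<in> borel_measurable P" for i using p by (simp add: unit_poisson_process_def)
  note [measurable] = A(1) poisson_point_count_measurable[OF P p A]
  let ?m = "measure lborel A"
  let ?N = "\<lambda>k. {\<omega> \<in> space P. point_count p A \<omega> = k}"
  have fin: "AE \<omega> in P. finite {i. p i \<omega> \<in> A}"
    and pois: "\<And>k. prob (?N k) = ?m ^ k / fact k * exp (- ?m)"
    using p A by (auto simp: unit_poisson_process_def)
  have "(\<Sum>i. emeasure P {\<omega> \<in> space P. p i \<omega> \<in> A}) =
      (\<Sum>i. \<integral>\<^sup>+\<omega>. indicator {\<omega> \<in> space P. p i \<omega> \<in> A} \<omega> \<partial>P)"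
    by (subst nn_integral_indicator) auto
  also have "\<dots> = (\<integral>\<^sup>+\<omega>. (\<Sum>i. indicator {\<omega> \<in> space P. p i \<omega> \<in> A} \<omega>) \<partial>P)"
    by (rule nn_integral_suminf[symmetric]) measurable
  also have "\<dots> = (\<integral>\<^sup>+\<omega>. (\<Sum>k. of_nat k * indicator (?N k) \<omega>) \<partial>P)"
  proof (rule nn_integral_cong_AE)
    show "AE \<omega> in P. (\<Sum>i. indicator {\<omega> \<in> space P. p i \<omega> \<in> A} \<omega> :: ennreal) = (\<Sum>k. of_nat k * indicator (?N k) \<omega>)"
      using fin AE_space
    proof eventually_elim
      case (elim \<omega>)
      have "(\<Sum>i. indicator {\<omega> \<in> space P. p i \<omega> \<in> A} \<omega> :: ennreal) = (\<Sum>i. indicator {i. p i \<omega> \<in> A} i)"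
        using elim by (intro suminf_cong) (auto simp: indicator_def)
      also have "\<dots> = of_nat (point_count p A \<omega>)"
        using elim by (simp add: suminf_indicator_eq_card point_count_def)
      also have "\<dots> = (\<Sum>k\<in>{point_count p A \<omega>}. of_nat k * indicator (?N k) \<omega>)"
        using elim by simp
      also have "\<dots> = (\<Sum>k. of_nat k * indicator (?N k) \<omega>)"
        by (rule suminf_finite[symmetric]) auto
      finally show ?case .
    qed
  qed
  also have "\<dots> = (\<Sum>k. \<integral>\<^sup>+\<omega>. of_nat k * indicator (?N k) \<omega> \<partial>P)"
    by (rule nn_integral_suminf) measurable
  also have "\<dots> = (\<Sum>k. of_nat k * ennreal (?m ^ k / fact k * exp (- ?m)))"
    by (subst nn_integral_cmult_indicator) (auto simp: emeasure_eq_measure pois)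
  also have "\<dots> = ennreal ?m" by (rule suminf_poisson_mean) simp
  also have "\<dots> = emeasure lborel A" using A(2) by (simp add: emeasure_eq_ennreal_measure)
  finally show ?thesis .
qed

text \<open>
  The void event lies in the event that \<open>point_count\<close> vanishes, which also covers the case of infinitely
  many points in \<open>A\<close>; hence the inequality.
\<close>

lemma poisson_void_probability_le:
  assumes P: "prob_space P" and p: "unit_poisson_process P p"
    and A: "A \<in> sets borel" "emeasure lborel A < \<infinity>"
  shows "measure P {\<omega> \<in> space P. \<forall>i. p i \<omega> \<notin> A} \<le> exp (- measure lborel A)"
proof -
  interpret prob_space P by fact
  note [measurable] = poisson_point_count_measurable[OF P p A]
  have "{\<omega> \<in> space P. point_count p A \<omega> = 0} \<in> events" by measurable
  then have "prob {\<omega> \<in> space P. \<forall>i. p i \<omega> \<notin> A} \<le> prob {\<omega> \<in> space P. point_count p A \<omega> = 0}"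
    by (intro finite_measure_mono) (auto simp: point_count_def)
  also have "\<dots> = measure lborel A ^ 0 / fact 0 * exp (- measure lborel A)"
    using p A by (simp add: unit_poisson_process_def del: power_0)
  finally show ?thesis by simp
qed

text \<open>
  Independence is given for the whole sequences of points and of leaves; it is used here only for a
  point and the leaf with the same index.
\<close>

lemma marked_point_distribution:
  assumes "dead_leaves_process P \<mu> x t L"
  shows "distr P (borel \<Otimes>\<^sub>M borel_of fell_topology) (\<lambda>\<omega>. ((x i \<omega>, t i \<omega>), L i \<omega>)) =
    distr P borel (\<lambda>\<omega>. (x i \<omega>, t i \<omega>)) \<Otimes>\<^sub>M \<mu>"
proof -
  interpret prob_space P using assms by (simp add: dead_leaves_process_def)
  let ?p = "\<lambda>\<omega>. (x i \<omega>, t i \<omega>)"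
  have p_meas: "?p \<in> borel_measurable P"
    using assms by (simp add: dead_leaves_process_def unit_poisson_process_def)
  have L_meas: "L i \<in> P \<rightarrow>\<^sub>M borel_of fell_topology" and \<mu>: "\<mu> = distr P (borel_of fell_topology) (L i)"
    using assms by (auto simp: dead_leaves_process_def random_closed_set_def)
  note [measurable] = p_meas L_meas
  have "prob (?p -` A \<inter> space P \<inter> (L i -` B \<inter> space P)) = prob (?p -` A \<inter> space P) * prob (L i -` B \<inter> space P)"
    if [measurable]: "A \<in> sets borel" "B \<in> sets (borel_of fell_topology)" for A B
  proof -
    let ?X = "\<lambda>\<omega>. \<lambda>i\<in>UNIV. (x i \<omega>, t i \<omega>)" and ?Y = "\<lambda>\<omega>. \<lambda>i\<in>UNIV. L i \<omega>"
    let ?S = "Pi\<^sub>M UNIV (\<lambda>_. borel) :: (nat \<Rightarrow> 'b \<times> real) measure"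
    let ?T = "Pi\<^sub>M UNIV (\<lambda>_. borel_of fell_topology) :: (nat \<Rightarrow> 'b set) measure"
    have ind: "indep_set {?X -` A \<inter> space P |A. A \<in> sets ?S} {?Y -` B \<inter> space P |B. B \<in> sets ?T}"
      and XY: "?X \<in> P \<rightarrow>\<^sub>M ?S" "?Y \<in> P \<rightarrow>\<^sub>M ?T"
      using assms by (auto simp: dead_leaves_process_def independent_rvs_def)
    have "?p -` A \<inter> space P = ?X -` ((\<lambda>f. f i) -` A \<inter> space ?S) \<inter> space P"
      using measurable_space[OF XY(1)] by auto
    moreover have "(\<lambda>f. f i) -` A \<inter> space ?S \<in> sets ?S" by measurable
    moreover have "L i -` B \<inter> space P = ?Y -` ((\<lambda>f. f i) -` B \<inter> space ?T) \<inter> space P"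
      using measurable_space[OF XY(2)] by auto
    moreover have "(\<lambda>f. f i) -` B \<inter> space ?T \<in> sets ?T" by measurable
    ultimately show ?thesis by (intro indep_setD[OF ind]) blast+
  qed
  note indep = this
  interpret p: prob_space "distr P borel ?p" by (rule prob_space_distr) measurable
  interpret m: prob_space \<mu> unfolding \<mu> by (rule prob_space_distr) measurable
  show ?thesis
  proof (rule pair_measure_eqI[symmetric])
    show "sigma_finite_measure (distr P borel ?p)" "sigma_finite_measure \<mu>" by unfold_locales
    show "sets (distr P borel ?p \<Otimes>\<^sub>M \<mu>) =
        sets (distr P (borel \<Otimes>\<^sub>M borel_of fell_topology) (\<lambda>\<omega>. (?p \<omega>, L i \<omega>)))"
      by (simp add: \<mu> cong: sets_pair_measure_cong)
    fix A B assume "A \<in> sets (distr P borel ?p)" "B \<in> sets \<mu>"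
    then have AB[measurable]: "A \<in> sets borel" "B \<in> sets (borel_of fell_topology)" by (auto simp: \<mu>)
    have "(\<lambda>\<omega>. (?p \<omega>, L i \<omega>)) -` (A \<times> B) \<inter> space P = ?p -` A \<inter> space P \<inter> (L i -` B \<inter> space P)"
      by auto
    then show "emeasure (distr P borel ?p) A * emeasure \<mu> B =
        emeasure (distr P (borel \<Otimes>\<^sub>M borel_of fell_topology) (\<lambda>\<omega>. (?p \<omega>, L i \<omega>))) (A \<times> B)"
      using indep[OF AB] unfolding \<mu>
      by (simp add: emeasure_distr emeasure_eq_measure ennreal_mult'')
  qed
qed

text \<open>
  Campbell's formula for the marked process: integrating out the leaf first reduces it to the
  intensity of the points alone, applied to each slice of \<open>E\<close> at a fixed leaf.
\<close>

lemma marked_intensity: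
  fixes x :: "nat \<Rightarrow> 'w \<Rightarrow> 'a::euclidean_space"
  assumes dl: "dead_leaves_process P \<mu> x t L"
    and E[measurable]: "E \<in> sets (borel \<Otimes>\<^sub>M borel_of fell_topology)"
    and slice: "\<And>l. closed l \<Longrightarrow> emeasure lborel ((\<lambda>p. (p, l)) -` E) < \<infinity>"
  shows "(\<Sum>i. emeasure P {\<omega> \<in> space P. ((x i \<omega>, t i \<omega>), L i \<omega>) \<in> E}) =
    (\<integral>\<^sup>+l. emeasure lborel ((\<lambda>p. (p, l)) -` E) \<partial>\<mu>)"
proof -
  interpret prob_space P using dl by (simp add: dead_leaves_process_def)
  have pp: "unit_poisson_process P (\<lambda>i \<omega>. (x i \<omega>, t i \<omega>))"
    using dl by (simp add: dead_leaves_process_def)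
  then have p_meas[measurable]: "(\<lambda>\<omega>. (x i \<omega>, t i \<omega>)) \<in> borel_measurable P" for i
    by (simp add: unit_poisson_process_def)
  have L_meas[measurable]: "L i \<in> P \<rightarrow>\<^sub>M borel_of fell_topology"
    and \<mu>: "\<mu> = distr P (borel_of fell_topology) (L i)" for i
    using dl by (auto simp: dead_leaves_process_def random_closed_set_def)
  have sets_\<mu>: "sets \<mu> = sets (borel_of fell_topology)" using \<mu>[of 0] by simp
  have space_\<mu>: "space \<mu> = {F. closed F}" using \<mu>[of 0] by (simp add: space_borel_of_fell)
  interpret m: prob_space \<mu> unfolding \<mu>[of 0] by (rule prob_space_distr) measurable
  have slice_sets[measurable]: "(\<lambda>p. (p, l)) -` E \<in> sets borel" for l
    by (rule sets_Pair2[OF E])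
  have "emeasure P {\<omega> \<in> space P. ((x i \<omega>, t i \<omega>), L i \<omega>) \<in> E} =
      (\<integral>\<^sup>+l. emeasure P {\<omega> \<in> space P. (x i \<omega>, t i \<omega>) \<in> (\<lambda>p. (p, l)) -` E} \<partial>\<mu>)" for i
  proof -
    let ?p = "\<lambda>\<omega>. (x i \<omega>, t i \<omega>)"
    interpret p: prob_space "distr P borel ?p" by (rule prob_space_distr) measurable
    interpret pair_sigma_finite "distr P borel ?p" \<mu> by unfold_locales
    have "emeasure P {\<omega> \<in> space P. (?p \<omega>, L i \<omega>) \<in> E} =
        emeasure (distr P (borel \<Otimes>\<^sub>M borel_of fell_topology) (\<lambda>\<omega>. (?p \<omega>, L i \<omega>))) E"
      by (subst emeasure_distr) (auto simp: vimage_def Int_def conj_commute)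
    also have "\<dots> = (\<integral>\<^sup>+l. emeasure (distr P borel ?p) ((\<lambda>p. (p, l)) -` E) \<partial>\<mu>)"
      unfolding marked_point_distribution[OF dl]
      by (rule emeasure_pair_measure_alt2) (simp add: sets_\<mu> cong: sets_pair_measure_cong)
    also have "\<dots> = (\<integral>\<^sup>+l. emeasure P {\<omega> \<in> space P. ?p \<omega> \<in> (\<lambda>p. (p, l)) -` E} \<partial>\<mu>)"
      by (intro nn_integral_cong, subst emeasure_distr[OF p_meas slice_sets])
        (simp add: vimage_def Int_def conj_commute)
    finally show ?thesis .
  qed
  then have "(\<Sum>i. emeasure P {\<omega> \<in> space P. ((x i \<omega>, t i \<omega>), L i \<omega>) \<in> E}) =
      (\<Sum>i. \<integral>\<^sup>+l. emeasure P {\<omega> \<in> space P. (x i \<omega>, t i \<omega>) \<in> (\<lambda>p. (p, l)) -` E} \<partial>\<mu>)"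
    by simp
  also have "\<dots> = (\<integral>\<^sup>+l. (\<Sum>i. emeasure P {\<omega> \<in> space P. (x i \<omega>, t i \<omega>) \<in> (\<lambda>p. (p, l)) -` E}) \<partial>\<mu>)"
  proof (rule nn_integral_suminf[symmetric])
    fix i
    let ?g = "\<lambda>q. ((x i (snd q), t i (snd q)), fst q)"
    let ?D = "?g -` E \<inter> space (borel_of fell_topology \<Otimes>\<^sub>M P)"
    have "?g \<in> borel_of fell_topology \<Otimes>\<^sub>M P \<rightarrow>\<^sub>M borel \<Otimes>\<^sub>M borel_of fell_topology"
      by (intro measurable_Pair measurable_compose[OF measurable_snd p_meas] measurable_fst)
    then have "?D \<in> sets (borel_of fell_topology \<Otimes>\<^sub>M P)" using E by (rule measurable_sets)
    then have "(\<lambda>l. emeasure P (Pair l -` ?D)) \<in> borel_measurable (borel_of fell_topology)"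
      by (rule measurable_emeasure_Pair)
    then show "(\<lambda>l. emeasure P {\<omega> \<in> space P. (x i \<omega>, t i \<omega>) \<in> (\<lambda>p. (p, l)) -` E}) \<in> borel_measurable \<mu>"
      unfolding measurable_cong_sets[OF sets_\<mu> refl]
      by (rule measurable_cong[THEN iffD1, rotated])
        (auto simp: space_pair_measure intro!: arg_cong[where f = "emeasure P"])
  qed
  also have "\<dots> = (\<integral>\<^sup>+l. emeasure lborel ((\<lambda>p. (p, l)) -` E) \<partial>\<mu>)"
    by (intro nn_integral_cong poisson_intensity[OF prob_space_axioms pp] slice slice_sets)
      (simp add: space_\<mu>)
  finally show ?thesis .
qed

section \<open>The radius of a leaf\<close>

text \<open>
  The values are extended because a leaf may be unbounded on a null event; this keeps the radius
  measurable on the whole Fell space.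
\<close>

definition leaf_radius :: "'a::euclidean_space set \<Rightarrow> ennreal" where
  "leaf_radius l = (SUP y\<in>l. ennreal (norm y))"

lemma random_closed_set_id: "random_closed_set (borel_of fell_topology) (\<lambda>l. l)"
  by (simp add: random_closed_set_def)

lemma leaf_radius_measurable[measurable]:
  "leaf_radius \<in> borel_measurable (borel_of fell_topology)"
proof (rule borel_measurableI_greater)
  fix a :: ennreal
  have "open {y::'a. a < ennreal (norm y)}"
    by (intro open_Collect_less continuous_intros continuous_on_ennreal)
  from random_closed_set_hits[OF random_closed_set_id this]
  show "{l \<in> space (borel_of fell_topology). a < leaf_radius (l::'a set)} \<in> sets (borel_of fell_topology)"
    by (simp add: leaf_radius_def less_SUP_iff disjoint_iff Bex_def)
qed

lemma leaf_radius_le: "l \<subseteq> cball 0 r \<Longrightarrow> leaf_radius l \<le> ennreal r"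
  unfolding leaf_radius_def by (intro SUP_least ennreal_leI) auto

lemma norm_le_leaf_radius: "y \<in> l \<Longrightarrow> ennreal (norm y) \<le> leaf_radius l"
  unfolding leaf_radius_def by (rule SUP_upper)

section \<open>Power-law radii\<close>

lemma power_law_tail_finite:
  fixes r1 :: ereal
  assumes "0 < \<delta>" and "\<beta> > 1 \<or> r1 < \<infinity>"
  shows "(\<integral>\<^sup>+r. ennreal (r powr (- \<beta>)) * indicator {r. \<delta> \<le> r \<and> ereal r \<le> r1} r \<partial>lborel) < \<infinity>"
  using assms(2)
proof
  assume "\<beta> > 1"
  have "(\<integral>\<^sup>+r. ennreal (r powr (- \<beta>)) * indicator {r. \<delta> \<le> r \<and> ereal r \<le> r1} r \<partial>lborel) \<le>
      (\<integral>\<^sup>+r. ennreal (r powr (- \<beta>)) * indicator {\<delta>..} r \<partial>lborel)"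
    by (intro nn_integral_mono) (auto simp: indicator_def)
  also have "\<dots> = ennreal (0 - \<delta> powr (1 - \<beta>) / (1 - \<beta>))"
  proof (rule nn_integral_FTC_atLeast)
    show "DERIV (\<lambda>r. r powr (1 - \<beta>) / (1 - \<beta>)) r :> r powr (- \<beta>)" if "\<delta> \<le> r" for r
      using DERIV_cdivide[OF has_real_derivative_powr[of r "1 - \<beta>"], of "1 - \<beta>"]
        that \<open>0 < \<delta>\<close> \<open>\<beta> > 1\<close> by simp
    have "((\<lambda>r. r powr (1 - \<beta>)) \<longlongrightarrow> 0) at_top"
      using \<open>\<beta> > 1\<close> by (intro tendsto_neg_powr filterlim_ident) auto
    then have "((\<lambda>r. r powr (1 - \<beta>) / (1 - \<beta>)) \<longlongrightarrow> 0 / (1 - \<beta>)) at_top"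
      using \<open>\<beta> > 1\<close> by (intro tendsto_intros) auto
    then show "((\<lambda>r. r powr (1 - \<beta>) / (1 - \<beta>)) \<longlongrightarrow> 0) at_top" by simp
  qed auto
  finally show ?thesis using order_le_less_trans by fastforce
next
  assume "r1 < \<infinity>"
  then obtain b :: real where b: "\<And>r. ereal r \<le> r1 \<Longrightarrow> r \<le> b"
    by (cases r1) auto
  have "bounded ((\<lambda>r. r powr (- \<beta>)) ` {\<delta>..b})"
    using \<open>0 < \<delta>\<close> by (intro compact_imp_bounded compact_continuous_image continuous_intros) auto
  then obtain K where "\<forall>r\<in>{\<delta>..b}. norm (r powr (- \<beta>)) \<le> K" by (auto simp: bounded_iff)
  then have K: "\<And>r. \<delta> \<le> r \<Longrightarrow> r \<le> b \<Longrightarrow> r powr (- \<beta>) \<le> K" by auto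
  have "(\<integral>\<^sup>+r. ennreal (r powr (- \<beta>)) * indicator {r. \<delta> \<le> r \<and> ereal r \<le> r1} r \<partial>lborel) \<le>
      (\<integral>\<^sup>+r. ennreal K * indicator {\<delta>..b} r \<partial>lborel)"
    using b K by (intro nn_integral_mono) (auto simp: indicator_def intro!: ennreal_leI)
  also have "\<dots> = ennreal K * emeasure lborel {\<delta>..b}" by (subst nn_integral_cmult_indicator) auto
  also have "\<dots> < \<infinity>" by (simp add: emeasure_lborel_Icc_eq ennreal_mult_less_top)
  finally show ?thesis .
qed

definition power_law_density :: "real \<Rightarrow> real \<Rightarrow> real \<Rightarrow> ereal \<Rightarrow> real \<Rightarrow> ennreal" where
  "power_law_density c \<alpha> r0 r1 r = ennreal (c * r powr (- \<alpha>) * indicator {r. r0 \<le> r \<and> ereal r \<le> r1} r)"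

text \<open>
  On \<open>[r0, 2 r0]\<close> the density is at least \<open>c (2 r0)\<^sup>-\<^sup>\<alpha>\<close>, and the total mass is \<open>1\<close>.
\<close>

lemma power_law_constant_le:
  assumes Q: "prob_space Q" and R: "distributed Q lborel R (power_law_density c \<alpha> r0 r1)"
    and "0 < c" "0 < r0" "ereal (2 * r0) \<le> r1" "0 \<le> \<alpha>"
  shows "c \<le> 2 powr \<alpha> * r0 powr (\<alpha> - 1)"
proof -
  interpret prob_space Q by fact
  let ?b = "c * (2 * r0) powr (- \<alpha>)"
  have ge: "c * r powr (- \<alpha>) \<ge> ?b" if "r0 \<le> r" "r \<le> 2 * r0" for r
    using that assms(3,4,6) by (intro mult_left_mono powr_mono2') auto
  have up: "ereal r \<le> r1" if "r \<le> 2 * r0" for r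
    using that assms(5) by (meson ereal_less_eq(3) order_trans)
  have "ennreal (?b * r0) = (\<integral>\<^sup>+r. ennreal ?b * indicator {r0..2 * r0} r \<partial>lborel)"
    using \<open>0 < r0\<close> \<open>0 < c\<close> by (subst nn_integral_cmult_indicator) (auto simp: ennreal_mult)
  also have "\<dots> \<le> (\<integral>\<^sup>+r. power_law_density c \<alpha> r0 r1 r * indicator UNIV r \<partial>lborel)"
    using ge up by (intro nn_integral_mono) (auto simp: power_law_density_def indicator_def intro!: ennreal_leI)
  also have "\<dots> = emeasure Q (R -` UNIV \<inter> space Q)"
    by (rule distributed_emeasure[OF R, symmetric]) auto
  also have "\<dots> = 1" by (simp add: emeasure_space_1)
  finally have "?b * r0 \<le> 1" by (metis ennreal_1 ennreal_le_iff zero_le_one)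
  then have "c \<le> (2 * r0) powr \<alpha> / r0"
    using \<open>0 < r0\<close> by (simp add: powr_minus field_simps)
  also have "\<dots> = 2 powr \<alpha> * r0 powr (\<alpha> - 1)"
    using \<open>0 < r0\<close> by (simp add: powr_mult powr_diff)
  finally show ?thesis .
qed

lemma power_law_moment_tail:
  assumes R: "distributed Q lborel R (power_law_density c \<alpha> r0 r1)" and "0 < c" "0 < \<delta>"
  shows "(\<integral>\<^sup>+\<omega>. ennreal (R \<omega> ^ d) * indicator {\<delta>..} (R \<omega>) \<partial>Q) \<le>
    ennreal c * (\<integral>\<^sup>+r. ennreal (r powr (- (\<alpha> - real d))) * indicator {r. \<delta> \<le> r \<and> ereal r \<le> r1} r \<partial>lborel)"
proof -
  have "(\<integral>\<^sup>+\<omega>. ennreal (R \<omega> ^ d) * indicator {\<delta>..} (R \<omega>) \<partial>Q) =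
      (\<integral>\<^sup>+r. power_law_density c \<alpha> r0 r1 r * (ennreal (r ^ d) * indicator {\<delta>..} r) \<partial>lborel)"
    by (rule distributed_nn_integral[OF R, symmetric]) measurable
  also have "\<dots> \<le> (\<integral>\<^sup>+r. ennreal c * (ennreal (r powr (- (\<alpha> - real d))) * indicator {r. \<delta> \<le> r \<and> ereal r \<le> r1} r) \<partial>lborel)"
  proof (rule nn_integral_mono)
    fix r :: real
    have "c * r powr (- \<alpha>) * r ^ d = c * r powr (- (\<alpha> - real d))" if "r > 0"
      using that by (simp add: powr_diff powr_minus powr_realpow field_simps)
    then show "power_law_density c \<alpha> r0 r1 r * (ennreal (r ^ d) * indicator {\<delta>..} r) \<le>
        ennreal c * (ennreal (r powr (- (\<alpha> - real d))) * indicator {r. \<delta> \<le> r \<and> ereal r \<le> r1} r)"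
      using \<open>0 < c\<close> \<open>0 < \<delta>\<close>
      by (auto simp: power_law_density_def indicator_def ennreal_mult'[symmetric] mult.assoc)
  qed
  also have "\<dots> = ennreal c * (\<integral>\<^sup>+r. ennreal (r powr (- (\<alpha> - real d))) * indicator {r. \<delta> \<le> r \<and> ereal r \<le> r1} r \<partial>lborel)"
    by (rule nn_integral_cmult) measurable
  finally show ?thesis .
qed

section \<open>The expected number of large leaves near a ball\<close>

text \<open>
  The marked points \<open>((x, t), l)\<close> with \<open>t \<in> [-T, 0]\<close> whose leaf has finite radius larger than \<open>\<delta>\<close>
  and could, judging by this radius, reach the ball of radius \<open>K\<close> around \<open>c\<close>. Using the radius
  instead of the leaf itself makes the set visibly measurable and its slices cylinders.
\<close>

definition near_large :: "'a::euclidean_space \<Rightarrow> real \<Rightarrow> real \<Rightarrow> real \<Rightarrow> (('a \<times> real) \<times> 'a set) set" where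
  "near_large c K \<delta> T = {(p, l). closed l \<and> snd p \<in> {- T..0} \<and>
     ennreal \<delta> < leaf_radius l \<and> leaf_radius l < \<top> \<and> dist (fst p) c \<le> K + enn2real (leaf_radius l)}"

lemma near_large_sets[measurable]:
  fixes c :: "'a::euclidean_space"
  shows "near_large c K \<delta> T \<in> sets (borel \<Otimes>\<^sub>M borel_of fell_topology)"
proof -
  let ?M = "borel \<Otimes>\<^sub>M borel_of fell_topology :: (('a \<times> real) \<times> 'a set) measure"
  have [measurable]: "(\<lambda>q. fst (fst q)) \<in> borel_measurable ?M" "(\<lambda>q. snd (fst q)) \<in> borel_measurable ?M"
    by (auto intro!: measurable_compose[OF measurable_fst] borel_measurable_continuous_onI continuous_intros)
  have "near_large c K \<delta> T = {q \<in> space ?M. snd (fst q) \<in> {- T..0} \<and> ennreal \<delta> < leaf_radius (snd q) \<and>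
      leaf_radius (snd q) < \<top> \<and> dist (fst (fst q)) c \<le> K + enn2real (leaf_radius (snd q))}"
    by (auto simp: near_large_def space_pair_measure space_borel_of_fell)
  also have "\<dots> \<in> sets ?M" unfolding atLeastAtMost_iff by measurable
  finally show ?thesis .
qed

lemma emeasure_lborel_times:
  fixes A :: "'a::euclidean_space set" and B :: "'b::euclidean_space set"
  assumes "A \<in> sets borel" "B \<in> sets borel"
  shows "emeasure lborel (A \<times> B) = emeasure lborel A * emeasure lborel B"
  using assms by (simp add: lborel_prod[symmetric] lborel.emeasure_pair_measure_Times)

lemma emeasure_near_large_slice:
  fixes l :: "'a::euclidean_space set"
  assumes "closed l" "0 \<le> K" "0 \<le> T"
  shows "emeasure lborel ((\<lambda>p. (p, l)) -` near_large c K \<delta> T) =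
    (if ennreal \<delta> < leaf_radius l \<and> leaf_radius l < \<top>
     then ennreal (T * unit_ball_vol (real DIM('a)) * (K + enn2real (leaf_radius l)) ^ DIM('a)) else 0)"
proof -
  have "(\<lambda>p. (p, l)) -` near_large c K \<delta> T =
      (if ennreal \<delta> < leaf_radius l \<and> leaf_radius l < \<top>
       then cball c (K + enn2real (leaf_radius l)) \<times> {- T..0} else {})"
    using assms(1) by (auto simp: near_large_def dist_commute)
  then show ?thesis
    using assms(2,3)
    by (auto simp: emeasure_lborel_times emeasure_cball ennreal_mult[symmetric] mult_ac)
qed

text \<open>
  The slice at a leaf of radius \<open>s\<close> has volume proportional to \<open>(K + s)\<^sup>d\<close>. Since \<open>\<delta> < s \<le> a R\<close>, the
  constant \<open>K\<close> is at most \<open>(K a / \<delta>) R\<close>, so the volume is at most a constant times \<open>R\<^sup>d\<close>.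
\<close>

lemma near_large_intensity:
  fixes x :: "nat \<Rightarrow> 'w \<Rightarrow> 'a::euclidean_space"
  assumes dl: "dead_leaves_process P (distr Q (borel_of fell_topology) (scaled_set R Y)) x t L"
    and Y: "random_closed_set Q Y" and R: "R \<in> borel_measurable Q" and pos: "AE \<omega> in Q. 0 \<le> R \<omega>"
    and a: "AE \<omega> in Q. Y \<omega> \<subseteq> cball 0 a" "0 < a" and "0 \<le> K" "0 \<le> T" "0 < \<delta>"
  shows "(\<Sum>i. emeasure P {\<omega> \<in> space P. ((x i \<omega>, t i \<omega>), L i \<omega>) \<in> near_large c K \<delta> T}) \<le>
    ennreal (T * unit_ball_vol (real DIM('a)) * (K * a / \<delta> + a) ^ DIM('a)) *
      (\<integral>\<^sup>+\<omega>. ennreal (R \<omega> ^ DIM('a)) * indicator {\<delta> / a..} (R \<omega>) \<partial>Q)"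
proof -
  let ?V = "unit_ball_vol (real DIM('a))"
  let ?Z = "scaled_set R Y"
  have "0 \<le> ?V" by simp
  have Z[measurable]: "?Z \<in> Q \<rightarrow>\<^sub>M borel_of fell_topology"
    using random_closed_set_scaling[OF R Y] by (simp add: random_closed_set_def)
  define g :: "'a set \<Rightarrow> ennreal" where "g l = (if ennreal \<delta> < leaf_radius l \<and> leaf_radius l < \<top>
     then ennreal (T * ?V * (K + enn2real (leaf_radius l)) ^ DIM('a)) else 0)" for l
  have [measurable]: "g \<in> borel_measurable (borel_of fell_topology)" unfolding g_def by measurable
  note [measurable] = R
  have slice: "emeasure lborel ((\<lambda>p. (p, l)) -` near_large c K \<delta> T) = g l" if "closed l" for l
    using emeasure_near_large_slice[OF that \<open>0 \<le> K\<close> \<open>0 \<le> T\<close>] by (simp add: g_def)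
  have "(\<Sum>i. emeasure P {\<omega> \<in> space P. ((x i \<omega>, t i \<omega>), L i \<omega>) \<in> near_large c K \<delta> T}) =
      (\<integral>\<^sup>+l. emeasure lborel ((\<lambda>p. (p, l)) -` near_large c K \<delta> T) \<partial>distr Q (borel_of fell_topology) ?Z)"
    by (rule marked_intensity[OF dl near_large_sets]) (simp add: slice g_def)
  also have "\<dots> = (\<integral>\<^sup>+l. g l \<partial>distr Q (borel_of fell_topology) ?Z)"
    by (intro nn_integral_cong slice) (simp add: space_borel_of_fell)
  also have "\<dots> = (\<integral>\<^sup>+\<omega>. g (?Z \<omega>) \<partial>Q)" by (rule nn_integral_distr) measurable
  also have "\<dots> \<le> (\<integral>\<^sup>+\<omega>. ennreal (T * ?V * (K * a / \<delta> + a) ^ DIM('a)) *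
      (ennreal (R \<omega> ^ DIM('a)) * indicator {\<delta> / a..} (R \<omega>)) \<partial>Q)"
  proof (rule nn_integral_mono_AE)
    show "AE \<omega> in Q. g (?Z \<omega>) \<le> ennreal (T * ?V * (K * a / \<delta> + a) ^ DIM('a)) *
      (ennreal (R \<omega> ^ DIM('a)) * indicator {\<delta> / a..} (R \<omega>))"
      using pos a(1)
    proof eventually_elim
      case (elim \<omega>)
      show ?case
      proof (cases "ennreal \<delta> < leaf_radius (?Z \<omega>) \<and> leaf_radius (?Z \<omega>) < \<top>")
        case True
        define s where "s = enn2real (leaf_radius (?Z \<omega>))"
        have s: "leaf_radius (?Z \<omega>) = ennreal s" "0 \<le> s" using True by (auto simp: s_def)
        have "?Z \<omega> \<subseteq> cball 0 (a * R \<omega>)"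
        proof
          fix z assume "z \<in> ?Z \<omega>"
          then obtain y where "y \<in> Y \<omega>" "z = R \<omega> *\<^sub>R y" by (auto simp: scaled_set_def)
          moreover have "norm y \<le> a" using elim(2) \<open>y \<in> Y \<omega>\<close> by auto
          ultimately show "z \<in> cball 0 (a * R \<omega>)"
            using elim(1) by (simp add: mult.commute[of a] mult_left_mono)
        qed
        then have "leaf_radius (?Z \<omega>) \<le> ennreal (a * R \<omega>)" by (rule leaf_radius_le)
        then have "s \<le> a * R \<omega>" using s elim(1) a(2) by (simp add: ennreal_le_iff)
        moreover have "\<delta> < s" using True s \<open>0 < \<delta>\<close> by (simp add: ennreal_less_iff)
        ultimately have Rge: "\<delta> / a \<le> R \<omega>" using a(2) by (simp add: field_simps)
        have "K * \<delta> \<le> K * (a * R \<omega>)" using \<open>s \<le> a * R \<omega>\<close> \<open>\<delta> < s\<close> \<open>0 \<le> K\<close> by (intro mult_left_mono) auto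
        then have "K \<le> K * a / \<delta> * R \<omega>" using \<open>0 < \<delta>\<close> by (simp add: field_simps)
        then have "K + s \<le> (K * a / \<delta> + a) * R \<omega>" using \<open>s \<le> a * R \<omega>\<close> by (simp add: algebra_simps)
        then have "(K + s) ^ DIM('a) \<le> ((K * a / \<delta> + a) * R \<omega>) ^ DIM('a)"
          using s(2) \<open>0 \<le> K\<close> by (intro power_mono) auto
        then have "T * ?V * (K + s) ^ DIM('a) \<le> T * ?V * (((K * a / \<delta> + a) * R \<omega>) ^ DIM('a))"
          using \<open>0 \<le> T\<close> \<open>0 \<le> ?V\<close> by (intro mult_left_mono) auto
        also have "\<dots> = T * ?V * (K * a / \<delta> + a) ^ DIM('a) * R \<omega> ^ DIM('a)"
          by (simp add: power_mult_distrib)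
        finally have "ennreal (T * ?V * (K + s) ^ DIM('a)) \<le>
            ennreal (T * ?V * (K * a / \<delta> + a) ^ DIM('a)) * ennreal (R \<omega> ^ DIM('a))"
          using elim(1) by (subst ennreal_mult''[symmetric]) (auto intro!: ennreal_leI)
        then show ?thesis using True Rge by (simp add: g_def s_def)
      next
        case False
        then show ?thesis by (auto simp: g_def)
      qed
    qed
  qed
  also have "\<dots> = ennreal (T * ?V * (K * a / \<delta> + a) ^ DIM('a)) *
      (\<integral>\<^sup>+\<omega>. ennreal (R \<omega> ^ DIM('a)) * indicator {\<delta> / a..} (R \<omega>) \<partial>Q)"
    by (rule nn_integral_cmult) measurable
  finally show ?thesis .
qed

section \<open>Almost sure local structure of the dead leaves model\<close>

lemma AE_finite_if_summable:
  assumes "finite_measure M" and A: "\<And>i. A i \<in> sets M"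
    and sum: "(\<Sum>i::nat. emeasure M (A i)) < \<infinity>"
  shows "AE \<omega> in M. finite {i. \<omega> \<in> A i}"
proof -
  interpret finite_measure M by fact
  have "summable (\<lambda>i. measure M (A i))"
    using sum by (intro summable_suminf_not_top) (auto simp: emeasure_eq_measure)
  then have "AE \<omega> in M. eventually (\<lambda>i. \<omega> \<in> space M - A i) sequentially"
    using A by (intro borel_cantelli_AE1) (auto simp: emeasure_eq_measure)
  then show ?thesis
  proof eventually_elim
    case (elim \<omega>)
    then have "eventually (\<lambda>i. \<omega> \<notin> A i) cofinite"
      unfolding cofinite_eq_sequentially by (rule eventually_mono) auto
    then show ?case by (simp add: eventually_cofinite)
  qed
qed

lemma AE_all_leaves:
  assumes dl: "dead_leaves_process P (distr Q (borel_of fell_topology) Z) x t L"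
    and Z: "Z \<in> Q \<rightarrow>\<^sub>M borel_of fell_topology"
    and \<Phi>: "{l \<in> space (borel_of fell_topology). \<Phi> l} \<in> sets (borel_of fell_topology)"
    and AE: "AE \<omega> in Q. \<Phi> (Z \<omega>)"
  shows "AE \<omega> in P. \<forall>i. \<Phi> (L i \<omega>)"
  unfolding AE_all_countable
proof
  fix i
  have L: "L i \<in> P \<rightarrow>\<^sub>M borel_of fell_topology"
    and eq: "distr P (borel_of fell_topology) (L i) = distr Q (borel_of fell_topology) Z"
    using dl by (auto simp: dead_leaves_process_def random_closed_set_def)
  have "AE l in distr Q (borel_of fell_topology) Z. \<Phi> l" using AE by (simp add: AE_distr_iff[OF Z \<Phi>])
  then show "AE \<omega> in P. \<Phi> (L i \<omega>)" unfolding eq[symmetric] by (simp add: AE_distr_iff[OF L \<Phi>])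
qed

lemma content_ball_times_interval:
  fixes c :: "'a::euclidean_space"
  assumes "0 \<le> T"
  shows "emeasure lborel (ball c \<rho> \<times> {- T<..<0}) = ennreal (measure lborel (ball c \<rho>) * T)"
proof -
  have "emeasure lborel (ball c \<rho>) = ennreal (measure lborel (ball c \<rho>))"
    using emeasure_lborel_ball_finite[of c \<rho>] by (intro emeasure_eq_ennreal_measure) auto
  then show ?thesis using assms by (simp add: emeasure_lborel_times ennreal_mult)
qed

lemma dead_leaves_void_le:
  fixes x :: "nat \<Rightarrow> 'w \<Rightarrow> 'a::euclidean_space"
  assumes dl: "dead_leaves_process P \<mu> x t L" and "0 \<le> T"
  shows "measure P {\<omega> \<in> space P. \<forall>i. (x i \<omega>, t i \<omega>) \<notin> ball c \<rho> \<times> {- T<..<0}} \<le>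
    exp (- measure lborel (ball c \<rho>) * T)"
proof -
  have "measure P {\<omega> \<in> space P. \<forall>i. (x i \<omega>, t i \<omega>) \<notin> ball c \<rho> \<times> {- T<..<0}} \<le>
      exp (- measure lborel (ball c \<rho> \<times> {- T<..<0}))"
    using dl by (intro poisson_void_probability_le)
      (auto simp: dead_leaves_process_def content_ball_times_interval[OF \<open>0 \<le> T\<close>] borel_Times)
  also have "measure lborel (ball c \<rho> \<times> {- T<..<0}) = measure lborel (ball c \<rho>) * T"
    using content_ball_times_interval[OF \<open>0 \<le> T\<close>, of c \<rho>] \<open>0 \<le> T\<close> by (simp add: measure_def)
  finally show ?thesis by simp
qed

lemma dead_leaves_measurable:
  fixes x :: "nat \<Rightarrow> 'w \<Rightarrow> 'a::euclidean_space"
  assumes "dead_leaves_process P \<mu> x t L"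
  shows "x i \<in> borel_measurable P" "t i \<in> borel_measurable P" "random_closed_set P (L i)"
    "(\<lambda>\<omega>. (x i \<omega>, t i \<omega>)) \<in> borel_measurable P"
proof -
  show p: "(\<lambda>\<omega>. (x i \<omega>, t i \<omega>)) \<in> borel_measurable P"
    using assms by (simp add: dead_leaves_process_def unit_poisson_process_def)
  show "x i \<in> borel_measurable P" "t i \<in> borel_measurable P"
    using measurable_compose[OF p borel_measurable_continuous_onI[OF continuous_on_fst[OF continuous_on_id]]]
      measurable_compose[OF p borel_measurable_continuous_onI[OF continuous_on_snd[OF continuous_on_id]]]
    by simp_all
  show "random_closed_set P (L i)" using assms by (simp add: dead_leaves_process_def)
qed

text \<open>
  Over the time interval \<open>(-T, 0)\<close> no point falls near \<open>d\<close> with probability at most \<open>exp (- V T)\<close>,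
  where \<open>V\<close> is the volume of the ball of radius \<open>\<epsilon>\<close>; let \<open>T\<close> tend to infinity.
\<close>

lemma AE_rain:
  fixes x :: "nat \<Rightarrow> 'w \<Rightarrow> 'a::euclidean_space"
  assumes dl: "dead_leaves_process P \<mu> x t L" and "0 < \<epsilon>"
  shows "AE \<omega> in P. \<exists>i. dist (x i \<omega>) d < \<epsilon> \<and> t i \<omega> < 0"
proof -
  interpret prob_space P using dl by (simp add: dead_leaves_process_def)
  note [measurable] = dead_leaves_measurable[OF dl]
  let ?A = "{\<omega> \<in> space P. \<not> (\<exists>i. dist (x i \<omega>) d < \<epsilon> \<and> t i \<omega> < 0)}"
  let ?V = "measure lborel (ball d \<epsilon>)"
  have A: "?A \<in> events" by measurable
  have "prob ?A \<le> exp (- ?V * real T)" for T :: nat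
  proof -
    have "prob ?A \<le> prob {\<omega> \<in> space P. \<forall>i. (x i \<omega>, t i \<omega>) \<notin> ball d \<epsilon> \<times> {- real T<..<0}}"
    proof (rule finite_measure_mono)
      have "{\<omega> \<in> space P. \<forall>i. \<not> (dist d (x i \<omega>) < \<epsilon> \<and> - real T < t i \<omega> \<and> t i \<omega> < 0)} \<in> events"
        by measurable
      then show "{\<omega> \<in> space P. \<forall>i. (x i \<omega>, t i \<omega>) \<notin> ball d \<epsilon> \<times> {- real T<..<0}} \<in> events"
        by simp
    qed (auto simp: dist_commute)
    also have "\<dots> \<le> exp (- ?V * real T)" by (rule dead_leaves_void_le[OF dl]) simp
    finally show ?thesis .
  qed
  moreover have "?V > 0" using \<open>0 < \<epsilon>\<close> by (simp add: content_ball_pos)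
  then have "(\<lambda>T. exp (- ?V * real T)) \<longlonglongrightarrow> 0" by real_asymp
  ultimately have "prob ?A \<le> 0" by (intro LIMSEQ_le_const[of _ 0]) auto
  then have "prob ?A = 0" using measure_nonneg[of P ?A] by linarith
  then have "emeasure P ?A = 0" by (simp only: emeasure_eq_measure ennreal_0)
  then show ?thesis using A by (intro AE_I[of _ _ ?A]) auto
qed

lemma power_law_AE_ge:
  assumes R: "distributed Q lborel R (power_law_density c \<alpha> r0 r1)"
  shows "AE \<omega> in Q. r0 \<le> R \<omega>"
proof -
  have [measurable]: "R \<in> borel_measurable Q" using distributed_measurable[OF R] by simp
  have "emeasure Q (R -` {..<r0} \<inter> space Q) = (\<integral>\<^sup>+r. power_law_density c \<alpha> r0 r1 r * indicator {..<r0} r \<partial>lborel)"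
    by (rule distributed_emeasure[OF R]) simp
  also have "\<dots> = (\<integral>\<^sup>+r. 0 \<partial>(lborel::real measure))"
    by (intro nn_integral_cong) (auto simp: power_law_density_def indicator_def)
  finally have "emeasure Q (R -` {..<r0} \<inter> space Q) = 0" by simp
  then show ?thesis by (intro AE_I[of _ _ "R -` {..<r0} \<inter> space Q"]) auto
qed

text \<open>
  The leaves are almost surely scaled by a factor at least \<open>r0\<close>, so a ball of fixed radius fits into all of
  them: this uniform core makes bounded regions get covered in finite time.
\<close>

lemma AE_core_and_radius:
  fixes x :: "nat \<Rightarrow> 'w \<Rightarrow> 'a::euclidean_space"
  assumes dl: "dead_leaves_process P (distr Q (borel_of fell_topology) (scaled_set R Y)) x t L"
    and Y: "random_closed_set Q Y" and R: "R \<in> borel_measurable Q"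
    and ge: "AE \<omega> in Q. r0 \<le> R \<omega>" and "0 < r0" "0 < a1"
    and shape: "AE \<omega> in Q. cball 0 a1 \<subseteq> Y \<omega> \<and> Y \<omega> \<subseteq> cball 0 a2"
  shows "AE \<omega> in P. \<forall>i. ball 0 (a1 * r0) \<subseteq> L i \<omega> \<and> leaf_radius (L i \<omega>) < \<top>"
proof (rule AE_all_leaves[OF dl])
  show "scaled_set R Y \<in> Q \<rightarrow>\<^sub>M borel_of fell_topology"
    using random_closed_set_scaling[OF R Y] by (simp add: random_closed_set_def)
  show "{l \<in> space (borel_of fell_topology). ball 0 (a1 * r0) \<subseteq> l \<and> leaf_radius (l::'a set) < \<top>} \<in>
      sets (borel_of fell_topology)"
    by (intro sets.sets_Collect_conj random_closed_set_supset_open[OF random_closed_set_id]) auto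
  show "AE \<omega> in Q. ball 0 (a1 * r0) \<subseteq> scaled_set R Y \<omega> \<and> leaf_radius (scaled_set R Y \<omega>) < \<top>"
    using ge shape
  proof eventually_elim
    case (elim \<omega>)
    then have "0 < R \<omega>" using \<open>0 < r0\<close> by simp
    have "ball 0 (a1 * r0) \<subseteq> scaled_set R Y \<omega>"
    proof
      fix z :: 'a assume "z \<in> ball 0 (a1 * r0)"
      then have "norm z \<le> a1 * R \<omega>"
        using elim(1) \<open>0 < a1\<close> by (smt (verit) mem_ball_0 mult_left_mono)
      then have "norm (z /\<^sub>R R \<omega>) \<le> a1" using \<open>0 < R \<omega>\<close> by (simp add: field_simps)
      then have "z /\<^sub>R R \<omega> \<in> Y \<omega>" using elim(2) by auto
      then show "z \<in> scaled_set R Y \<omega>"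
        using \<open>0 < R \<omega>\<close> unfolding scaled_set_def by (intro image_eqI[of _ _ "z /\<^sub>R R \<omega>"]) auto
    qed
    moreover have "scaled_set R Y \<omega> \<subseteq> cball 0 (R \<omega> * a2)"
    proof
      fix z assume "z \<in> scaled_set R Y \<omega>"
      then obtain y where "y \<in> Y \<omega>" "z = R \<omega> *\<^sub>R y" by (auto simp: scaled_set_def)
      moreover have "norm y \<le> a2" using elim(2) \<open>y \<in> Y \<omega>\<close> by auto
      ultimately show "z \<in> cball 0 (R \<omega> * a2)" using \<open>0 < R \<omega>\<close> by simp
    qed
    then have "leaf_radius (scaled_set R Y \<omega>) \<le> ennreal (R \<omega> * a2)" by (rule leaf_radius_le)
    ultimately show ?case using ennreal_less_top order_le_less_trans by blast
  qed
qed

lemma translated_leaf_near: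
  fixes a c :: "'a::euclidean_space"
  assumes "(+) a ` l \<inter> cball c K \<noteq> {}" "closed l" "leaf_radius l < \<top>"
    "s \<in> {- T..0}" "ennreal \<delta> < leaf_radius l"
  shows "((a, s), l) \<in> near_large c K \<delta> T"
proof -
  obtain y where y: "y \<in> l" "dist c (a + y) \<le> K" using assms(1) by auto
  have "ennreal (norm y) \<le> ennreal (enn2real (leaf_radius l))"
    using norm_le_leaf_radius[OF y(1)] assms(3) by simp
  then have "norm y \<le> enn2real (leaf_radius l)" by (simp add: ennreal_le_iff)
  moreover have "dist a c \<le> dist c (a + y) + norm y"
    using dist_triangle[of a c "a + y"] by (simp add: dist_commute dist_norm)
  ultimately show ?thesis using y(2) assms by (auto simp: near_large_def)
qed

text \<open>
  By the core, every leaf has radius above \<open>\<delta>\<close>. So all leaves that meet the ball are counted by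
  \<open>near_large\<close>, and the expected count is finite.
\<close>

lemma AE_locally_finite:
  fixes x :: "nat \<Rightarrow> 'w \<Rightarrow> 'a::euclidean_space"
  assumes dl: "dead_leaves_process P \<mu> x t L"
    and core: "AE \<omega> in P. \<forall>i. ball 0 r \<subseteq> L i \<omega> \<and> leaf_radius (L i \<omega>) < \<top>"
    and "0 < \<delta>" "\<delta> < r"
    and intensity: "\<And>N T::nat. (\<Sum>i. emeasure P {\<omega> \<in> space P.
        ((x i \<omega>, t i \<omega>), L i \<omega>) \<in> near_large 0 (real N) \<delta> (real T)}) < \<infinity>"
  shows "AE \<omega> in P. \<forall>N T::nat. finite {i. t i \<omega> \<in> {- real T..0} \<and>
      (+) (x i \<omega>) ` L i \<omega> \<inter> cball 0 (real N) \<noteq> {}}"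
proof -
  interpret prob_space P using dl by (simp add: dead_leaves_process_def)
  note [measurable] = dead_leaves_measurable[OF dl, unfolded random_closed_set_def]
  let ?A = "\<lambda>N T i. {\<omega> \<in> space P. ((x i \<omega>, t i \<omega>), L i \<omega>) \<in> near_large 0 (real N) \<delta> (real T)}"
  have "AE \<omega> in P. \<forall>N T::nat. finite {i. \<omega> \<in> ?A N T i}"
    unfolding AE_all_countable
    by (intro allI AE_finite_if_summable finite_measure_axioms intensity) measurable
  with core AE_space show ?thesis
  proof eventually_elim
    case (elim \<omega>)
    show ?case
    proof (intro allI)
      fix N T :: nat
      have "i \<in> {i. \<omega> \<in> ?A N T i}"
        if "t i \<omega> \<in> {- real T..0}" "(+) (x i \<omega>) ` L i \<omega> \<inter> cball 0 (real N) \<noteq> {}" for i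
      proof -
        \<comment> \<open>a point of the core at distance more than \<open>\<delta>\<close> from its centre\<close>
        obtain y :: 'a where y: "norm y = (\<delta> + r) / 2"
          using vector_choose_size[of "(\<delta> + r) / 2"] \<open>0 < \<delta>\<close> \<open>\<delta> < r\<close> by auto
        then have "y \<in> L i \<omega>" using elim(1) \<open>\<delta> < r\<close> by (auto simp: subset_iff)
        then have "ennreal ((\<delta> + r) / 2) \<le> leaf_radius (L i \<omega>)" using norm_le_leaf_radius y by metis
        moreover have "ennreal \<delta> < ennreal ((\<delta> + r) / 2)"
          using \<open>0 < \<delta>\<close> \<open>\<delta> < r\<close> by (intro ennreal_lessI) auto
        ultimately have "ennreal \<delta> < leaf_radius (L i \<omega>)" by simp
        then show ?thesis
          using translated_leaf_near[OF that(2) _ _ that(1)] elim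
            random_closed_set_closed[OF dead_leaves_measurable(3)[OF dl]] by auto
      qed
      then have "{i. t i \<omega> \<in> {- real T..0} \<and> (+) (x i \<omega>) ` L i \<omega> \<inter> cball 0 (real N) \<noteq> {}} \<subseteq>
          {i. \<omega> \<in> ?A N T i}" by blast
      then show "finite {i. t i \<omega> \<in> {- real T..0} \<and> (+) (x i \<omega>) ` L i \<omega> \<inter> cball 0 (real N) \<noteq> {}}"
        by (rule finite_subset) (use elim(3) in blast)
    qed
  qed
qed

lemma AE_closed_dead_leaves_boundary:
  fixes x :: "nat \<Rightarrow> 'w \<Rightarrow> 'a::euclidean_space"
  assumes dl: "dead_leaves_process P \<mu> x t L" and "0 < r"
    and core: "AE \<omega> in P. \<forall>i. ball 0 r \<subseteq> L i \<omega>"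
    and fin: "AE \<omega> in P. \<forall>N T::nat. finite {i. t i \<omega> \<in> {- real T..0} \<and>
      (+) (x i \<omega>) ` L i \<omega> \<inter> cball 0 (real N) \<noteq> {}}"
  shows "AE \<omega> in P. closed (dead_leaves_boundary x t L \<omega>)"
proof -
  obtain D :: "'a set" where D: "countable D" "\<And>X. open X \<Longrightarrow> X \<noteq> {} \<Longrightarrow> \<exists>d\<in>D. d \<in> X"
    by (rule countable_dense_setE) blast
  have dense: "\<exists>d\<in>D. dist d y < r / 2" for y
    using D(2)[of "ball y (r / 2)"] \<open>0 < r\<close> by (auto simp: dist_commute)
  have "AE \<omega> in P. \<forall>d\<in>D. \<exists>i. dist (x i \<omega>) d < r / 2 \<and> t i \<omega> < 0"
    using D(1) AE_rain[OF dl, of "r / 2"] \<open>0 < r\<close> by (simp add: AE_ball_countable)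
  with core fin AE_space show ?thesis
  proof eventually_elim
    case (elim \<omega>)
    show ?case
    proof (rule closed_dead_leaves_boundary[where \<epsilon> = "r / 2" and D = D])
      show "closed (L i \<omega>)" for i
        using random_closed_set_closed[OF dead_leaves_measurable(3)[OF dl] elim(3)] .
    qed (use elim dense in auto)
  qed
qed

section \<open>Convergence of the boundaries\<close>

text \<open>
  If a centre falls into the ball and no leaf of radius above \<open>\<rho>/2\<close> comes near it, then the boundary hits
  the ball; the second probability is bounded by the expected number of such leaves.
\<close>

lemma dead_leaves_boundary_miss_probability:
  fixes x :: "nat \<Rightarrow> 'w \<Rightarrow> 'a::euclidean_space"
  assumes dl: "dead_leaves_process P \<mu> x t L" and "0 < r" "0 < \<rho>" "0 \<le> T"
    and core: "AE \<omega> in P. \<forall>i. ball 0 r \<subseteq> L i \<omega> \<and> leaf_radius (L i \<omega>) < \<top>"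
    and fin: "AE \<omega> in P. \<forall>N T::nat. finite {i. t i \<omega> \<in> {- real T..0} \<and>
      (+) (x i \<omega>) ` L i \<omega> \<inter> cball 0 (real N) \<noteq> {}}"
    and B: "random_closed_set P B" "AE \<omega> in P. B \<omega> = dead_leaves_boundary x t L \<omega>"
    and "0 \<le> C" and C: "(\<Sum>i. emeasure P {\<omega> \<in> space P.
        ((x i \<omega>, t i \<omega>), L i \<omega>) \<in> near_large c \<rho> (\<rho> / 2) T}) \<le> ennreal C"
  shows "measure P {\<omega> \<in> space P. B \<omega> \<inter> ball c \<rho> = {}} \<le>
    exp (- measure lborel (ball c \<rho>) * T) + C"
proof -
  interpret prob_space P using dl by (simp add: dead_leaves_process_def)
  note [measurable] = dead_leaves_measurable[OF dl, unfolded random_closed_set_def]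
  define W where "W = {\<omega> \<in> space P. \<forall>i. (x i \<omega>, t i \<omega>) \<notin> ball c \<rho> \<times> {- T<..<0}}"
  define A where "A i = {\<omega> \<in> space P. ((x i \<omega>, t i \<omega>), L i \<omega>) \<in> near_large c \<rho> (\<rho> / 2) T}" for i
  have W: "W \<in> events"
  proof -
    have "{\<omega> \<in> space P. \<forall>i. \<not> (dist c (x i \<omega>) < \<rho> \<and> - T < t i \<omega> \<and> t i \<omega> < 0)} \<in> events"
      by measurable
    then show ?thesis by (simp add: W_def)
  qed
  have A[measurable]: "A i \<in> events" for i unfolding A_def by measurable
  have "AE \<omega> in P. \<omega> \<in> {\<omega> \<in> space P. B \<omega> \<inter> ball c \<rho> = {}} \<longrightarrow> \<omega> \<in> W \<union> (\<Union>i. A i)"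
    using core fin B(2) AE_space
  proof eventually_elim
    case (elim \<omega>)
    show ?case
    proof (rule impI, rule ccontr)
      assume miss: "\<omega> \<in> {\<omega> \<in> space P. B \<omega> \<inter> ball c \<rho> = {}}" and "\<omega> \<notin> W \<union> (\<Union>i. A i)"
      then obtain i where i: "(x i \<omega>, t i \<omega>) \<in> ball c \<rho> \<times> {- T<..<0}" and notA: "\<And>i. \<omega> \<notin> A i"
        using elim(4) by (auto simp: W_def)
      have "dead_leaves_boundary x t L \<omega> \<inter> ball c \<rho> \<noteq> {}"
      proof (rule dead_leaves_boundary_hits_ball[where \<epsilon> = r and i = i and T = T])
        show "ball 0 r \<subseteq> L i \<omega>" for i using elim(1) by blast
        show "finite {i. t i \<omega> \<in> {- real T..0} \<and> (+) (x i \<omega>) ` L i \<omega> \<inter> cball 0 (real N) \<noteq> {}}"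
          for N T :: nat using elim(2) by blast
        fix j assume j: "t j \<omega> \<in> {- T<..<0}" "(+) (x j \<omega>) ` L j \<omega> \<inter> ball c \<rho> \<noteq> {}"
        have "\<not> ennreal (\<rho> / 2) < leaf_radius (L j \<omega>)"
        proof
          assume "ennreal (\<rho> / 2) < leaf_radius (L j \<omega>)"
          moreover have "(+) (x j \<omega>) ` L j \<omega> \<inter> cball c \<rho> \<noteq> {}" using j(2) ball_subset_cball by blast
          ultimately have "((x j \<omega>, t j \<omega>), L j \<omega>) \<in> near_large c \<rho> (\<rho> / 2) T"
            using j(1) elim(1) random_closed_set_closed[OF dead_leaves_measurable(3)[OF dl] elim(4)]
            by (intro translated_leaf_near) auto
          then show False using notA[of j] elim(4) by (simp add: A_def)
        qed
        then have "ennreal (norm y) \<le> ennreal (\<rho> / 2)" if "y \<in> L j \<omega>" for y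
          using norm_le_leaf_radius[OF that] by (meson leI order_trans)
        then show "L j \<omega> \<subseteq> cball 0 (\<rho> / 2)" using \<open>0 < \<rho>\<close> by (auto simp: ennreal_le_iff)
      qed (use i \<open>0 < r\<close> \<open>0 < \<rho>\<close> in \<open>auto simp: dist_commute\<close>)
      then show False using miss elim(3) by auto
    qed
  qed
  then have "emeasure P {\<omega> \<in> space P. B \<omega> \<inter> ball c \<rho> = {}} \<le> emeasure P (W \<union> (\<Union>i. A i))"
    using W by (intro emeasure_mono_AE) auto
  also have "\<dots> \<le> emeasure P W + emeasure P (\<Union>i. A i)"
    using W by (intro emeasure_subadditive) auto
  also have "emeasure P (\<Union>i. A i) \<le> (\<Sum>i. emeasure P (A i))"
    by (intro emeasure_subadditive_countably) auto
  also have "\<dots> \<le> ennreal C" using C by (simp add: A_def)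
  also have "emeasure P W \<le> ennreal (exp (- measure lborel (ball c \<rho>) * T))"
    using dead_leaves_void_le[OF dl \<open>0 \<le> T\<close>, of c \<rho>]
    unfolding emeasure_eq_measure W_def by (intro ennreal_leI)
  finally have "emeasure P {\<omega> \<in> space P. B \<omega> \<inter> ball c \<rho> = {}} \<le>
      ennreal (exp (- measure lborel (ball c \<rho>) * T)) + ennreal C"
    by (simp add: add_mono)
  also have "\<dots> = ennreal (exp (- measure lborel (ball c \<rho>) * T) + C)"
    using \<open>0 \<le> C\<close> by (intro ennreal_plus[symmetric]) auto
  finally show ?thesis
    using \<open>0 \<le> C\<close> unfolding emeasure_eq_measure by (subst (asm) ennreal_le_iff) auto
qed

text \<open>
  The argument is the same in every dimension \<open>d\<close>; the condition on \<open>\<alpha>\<close> and \<open>r1\<close> says that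
  \<open>r\<^sup>d\<^sup>-\<^sup>\<alpha>\<close> is integrable at the upper end of the range of radii.
\<close>

theorem dead_leaves_boundary_converges:
  fixes \<alpha> a1 a2 :: real and r1 :: ereal
    and Y :: "'q \<Rightarrow> 'a::euclidean_space set"
    and x :: "real \<Rightarrow> nat \<Rightarrow> 'w \<Rightarrow> 'a"
  assumes \<alpha>: "1 < \<alpha>" "real DIM('a) + 1 < \<alpha> \<or> r1 < \<infinity>" "0 < r1"
    and Q: "prob_space Q" and Y: "random_closed_set Q Y"
    and a: "0 < a1" "a1 < a2"
    and shape: "AE \<omega> in Q. cball 0 a1 \<subseteq> Y \<omega> \<and> Y \<omega> \<subseteq> cball 0 a2"
    and R: "\<And>r0. 0 < r0 \<Longrightarrow> ereal r0 < r1 \<Longrightarrow> power_law_radius Q \<alpha> r0 r1 (R r0)"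
    and dl: "\<And>r0. 0 < r0 \<Longrightarrow> ereal r0 < r1 \<Longrightarrow>
      dead_leaves_process (P r0) (distr Q (borel_of fell_topology) (scaled_set (R r0) Y)) (x r0) (t r0) (L r0)"
  shows "\<exists>B. (\<forall>r0. 0 < r0 \<and> ereal r0 < r1 \<longrightarrow> random_closed_set (P r0) (B r0) \<and>
      (AE \<omega> in P r0. B r0 \<omega> = dead_leaves_boundary (x r0) (t r0) (L r0) \<omega>)) \<and>
    weakly_converges fell_topology (\<lambda>r0. distr (P r0) (borel_of fell_topology) (B r0))
      (return (borel_of fell_topology) UNIV) (at_right 0)"
proof -
  let ?d = "DIM('a)"
  define I where "I \<delta> = (\<integral>\<^sup>+r. ennreal (r powr (- (\<alpha> - real ?d))) *
    indicator {r. \<delta> \<le> r \<and> ereal r \<le> r1} r \<partial>lborel)" for \<delta>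
  have I_fin: "I \<delta> < \<infinity>" if "0 < \<delta>" for \<delta>
    unfolding I_def using that \<alpha>(2) by (intro power_law_tail_finite) auto
  define A where "A K \<delta> T = T * unit_ball_vol (real ?d) * (K * a2 / \<delta> + a2) ^ ?d *
    enn2real (I (\<delta> / a2))" for K \<delta> T
  have A_nonneg: "0 \<le> A K \<delta> T" if "0 \<le> K" "0 \<le> T" "0 < \<delta>" for K \<delta> T
    using that a unfolding A_def by (intro mult_nonneg_nonneg zero_le_power add_nonneg_nonneg) auto
  have "\<forall>r0\<in>{r0. 0 < r0 \<and> ereal r0 < r1}. \<exists>c>0. distributed Q lborel (R r0) (power_law_density c \<alpha> r0 r1)"
    using R by (auto simp: power_law_radius_def power_law_density_def[abs_def])
  then obtain c where c: "\<And>r0. 0 < r0 \<Longrightarrow> ereal r0 < r1 \<Longrightarrow> c r0 > 0"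
    "\<And>r0. 0 < r0 \<Longrightarrow> ereal r0 < r1 \<Longrightarrow> distributed Q lborel (R r0) (power_law_density (c r0) \<alpha> r0 r1)"
    by (metis (mono_tags, lifting) mem_Collect_eq)
  have R_meas: "R r0 \<in> borel_measurable Q" if "0 < r0" "ereal r0 < r1" for r0
    using distributed_measurable[OF c(2)[OF that]] by simp
  have R_ge: "AE \<omega> in Q. r0 \<le> R r0 \<omega>" if "0 < r0" "ereal r0 < r1" for r0
    by (rule power_law_AE_ge[OF c(2)[OF that]])
  have count: "(\<Sum>i. emeasure (P r0) {\<omega> \<in> space (P r0).
      ((x r0 i \<omega>, t r0 i \<omega>), L r0 i \<omega>) \<in> near_large z K \<delta> T}) \<le> ennreal (c r0 * A K \<delta> T)"
    if r0: "0 < r0" "ereal r0 < r1" and par: "0 \<le> K" "0 \<le> T" "0 < \<delta>" for r0 z K \<delta> T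
  proof -
    let ?C = "T * unit_ball_vol (real ?d) * (K * a2 / \<delta> + a2) ^ ?d"
    have "0 \<le> ?C" using par a by (intro mult_nonneg_nonneg zero_le_power add_nonneg_nonneg) auto
    have "(\<Sum>i. emeasure (P r0) {\<omega> \<in> space (P r0).
        ((x r0 i \<omega>, t r0 i \<omega>), L r0 i \<omega>) \<in> near_large z K \<delta> T}) \<le>
        ennreal ?C * (\<integral>\<^sup>+\<omega>. ennreal (R r0 \<omega> ^ ?d) * indicator {\<delta> / a2..} (R r0 \<omega>) \<partial>Q)"
    proof (rule near_large_intensity[OF dl[OF r0] Y R_meas[OF r0]])
      show "AE \<omega> in Q. 0 \<le> R r0 \<omega>" using R_ge[OF r0] by eventually_elim (use r0 in simp)
      show "AE \<omega> in Q. Y \<omega> \<subseteq> cball 0 a2" using shape by eventually_elim simp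
    qed (use par a in auto)
    also have "\<dots> \<le> ennreal ?C * (ennreal (c r0) * I (\<delta> / a2))"
      unfolding I_def using power_law_moment_tail[OF c(2)[OF r0] c(1)[OF r0], of "\<delta> / a2" ?d] par a
      by (intro mult_left_mono) auto
    also have "I (\<delta> / a2) = ennreal (enn2real (I (\<delta> / a2)))"
      using I_fin[of "\<delta> / a2"] par a by simp
    also have "ennreal ?C * (ennreal (c r0) * ennreal (enn2real (I (\<delta> / a2)))) = ennreal (c r0 * A K \<delta> T)"
      using \<open>0 \<le> ?C\<close> c(1)[OF r0] by (simp add: A_def ennreal_mult[symmetric] mult_ac)
    finally show ?thesis .
  qed
  have core: "AE \<omega> in P r0. \<forall>i. ball 0 (a1 * r0) \<subseteq> L r0 i \<omega> \<and> leaf_radius (L r0 i \<omega>) < \<top>"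
    if r0: "0 < r0" "ereal r0 < r1" for r0
    by (rule AE_core_and_radius[OF dl[OF r0] Y R_meas[OF r0] R_ge[OF r0] r0(1) a(1) shape])
  have fin: "AE \<omega> in P r0. \<forall>N T::nat. finite {i. t r0 i \<omega> \<in> {- real T..0} \<and>
      (+) (x r0 i \<omega>) ` L r0 i \<omega> \<inter> cball 0 (real N) \<noteq> {}}"
    if r0: "0 < r0" "ereal r0 < r1" for r0
  proof (rule AE_locally_finite[OF dl[OF r0] core[OF r0], of "a1 * r0 / 2"])
    show "(\<Sum>i. emeasure (P r0) {\<omega> \<in> space (P r0).
        ((x r0 i \<omega>, t r0 i \<omega>), L r0 i \<omega>) \<in> near_large 0 (real N) (a1 * r0 / 2) (real T)}) < \<infinity>" for N T
      using r0 a by (intro order_le_less_trans[OF count[OF r0]]) auto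
  qed (use r0 a in auto)
  have "\<forall>r0\<in>{r0. 0 < r0 \<and> ereal r0 < r1}. \<exists>B. random_closed_set (P r0) B \<and>
      (AE \<omega> in P r0. B \<omega> = dead_leaves_boundary (x r0) (t r0) (L r0) \<omega>)"
  proof safe
    fix r0 assume r0: "0 < r0" "ereal r0 < r1"
    have "AE \<omega> in P r0. closed (dead_leaves_boundary (x r0) (t r0) (L r0) \<omega>)"
    proof (rule AE_closed_dead_leaves_boundary[OF dl[OF r0], of "a1 * r0"])
      show "AE \<omega> in P r0. \<forall>i. ball 0 (a1 * r0) \<subseteq> L r0 i \<omega>" using core[OF r0] by eventually_elim simp
    qed (use fin[OF r0] r0 a in auto)
    then obtain B where "random_closed_set (P r0) B"
      "AE \<omega> in P r0. B \<omega> = dead_leaves_boundary (x r0) (t r0) (L r0) \<omega>"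
      by (rule random_closed_set_dead_leaves_boundary[OF dead_leaves_measurable(1-3)[OF dl[OF r0]]])
    then show "\<exists>B. random_closed_set (P r0) B \<and>
      (AE \<omega> in P r0. B \<omega> = dead_leaves_boundary (x r0) (t r0) (L r0) \<omega>)" by blast
  qed
  from bchoice[OF this] obtain B where B: "\<And>r0. 0 < r0 \<Longrightarrow> ereal r0 < r1 \<Longrightarrow> random_closed_set (P r0) (B r0)"
    "\<And>r0. 0 < r0 \<Longrightarrow> ereal r0 < r1 \<Longrightarrow> AE \<omega> in P r0. B r0 \<omega> = dead_leaves_boundary (x r0) (t r0) (L r0) \<omega>"
    by blast
  obtain b where b: "0 < b" "ereal b < r1"
    using ereal_dense2[of 0 r1] \<alpha>(3) by (auto simp: zero_ereal_def)
  have ev: "\<forall>\<^sub>F r0 in at_right (0::real). 0 < r0 \<and> ereal r0 < r1 \<and> ereal (2 * r0) \<le> r1"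
    unfolding eventually_at_right_field
  proof (intro exI[of _ "b / 2"] conjI allI impI)
    fix r0 :: real assume r0: "0 < r0" "r0 < b / 2"
    have "ereal r0 < ereal b" "ereal (2 * r0) \<le> ereal b" using r0 by auto
    then show "ereal r0 < r1" "ereal (2 * r0) \<le> r1"
      using b(2) by (meson less_imp_le less_trans order_trans)+
  qed (use b in auto)
  have "weakly_converges fell_topology (\<lambda>r0. distr (P r0) (borel_of fell_topology) (B r0))
      (return (borel_of fell_topology) UNIV) (at_right 0)"
  proof (rule weakly_converges_to_UNIV)
    show "\<forall>\<^sub>F r0 in at_right 0. prob_space (P r0) \<and> random_closed_set (P r0) (B r0)"
      using ev by eventually_elim (use B(1) dl in \<open>auto simp: dead_leaves_process_def\<close>)
  next
    fix G :: "'a set" assume "open G" "G \<noteq> {}"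
    then obtain z \<rho> where \<rho>: "0 < \<rho>" "ball z \<rho> \<subseteq> G" by (metis all_not_in_conv open_contains_ball)
    let ?V = "measure lborel (ball z \<rho>)"
    have "0 < ?V" using \<rho>(1) by (simp add: content_ball_pos)
    show "((\<lambda>r0. measure (P r0) {\<omega> \<in> space (P r0). B r0 \<omega> \<inter> G = {}}) \<longlongrightarrow> 0) (at_right 0)"
    proof (rule tendstoI)
      fix e :: real assume "0 < e"
      \<comment> \<open>the horizon after which \<open>exp (- V T) \<le> e / 2\<close>, independent of \<open>r0\<close>\<close>
      define T where "T = max 0 (- ln (e / 2) / ?V)"
      have "- ln (e / 2) \<le> ?V * T"
        using \<open>0 < ?V\<close> by (simp add: T_def max_def field_simps)
      then have "exp (- ?V * T) \<le> exp (ln (e / 2))" by simp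
      then have void: "exp (- ?V * T) \<le> e / 2" using \<open>0 < e\<close> by simp
      have "0 \<le> T" by (simp add: T_def)
      have "((\<lambda>r0. 2 powr \<alpha> * r0 powr (\<alpha> - 1) * A \<rho> (\<rho> / 2) T) \<longlongrightarrow>
          2 powr \<alpha> * 0 * A \<rho> (\<rho> / 2) T) (at_right 0)"
      proof (intro tendsto_intros)
        show "((\<lambda>r0::real. r0 powr (\<alpha> - 1)) \<longlongrightarrow> 0) (at_right 0)" using \<alpha>(1) by real_asymp
      qed
      then have "\<forall>\<^sub>F r0 in at_right 0. 2 powr \<alpha> * r0 powr (\<alpha> - 1) * A \<rho> (\<rho> / 2) T < e / 2"
        using \<open>0 < e\<close> by (intro order_tendstoD(2)) auto
      with ev show "\<forall>\<^sub>F r0 in at_right 0.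
          dist (measure (P r0) {\<omega> \<in> space (P r0). B r0 \<omega> \<inter> G = {}}) 0 < e"
      proof eventually_elim
        case (elim r0)
        then have r0: "0 < r0" "ereal r0 < r1" by auto
        interpret prob_space "P r0" using dl[OF r0] by (simp add: dead_leaves_process_def)
        have A: "0 \<le> A \<rho> (\<rho> / 2) T" using \<rho>(1) \<open>0 \<le> T\<close> by (intro A_nonneg) auto
        have "{\<omega> \<in> space (P r0). \<not> B r0 \<omega> \<inter> ball z \<rho> \<noteq> {}} \<in> events"
          by (intro sets.sets_Collect_neg random_closed_set_hits[OF B(1)[OF r0]]) auto
        then have "measure (P r0) {\<omega> \<in> space (P r0). B r0 \<omega> \<inter> G = {}} \<le>
            measure (P r0) {\<omega> \<in> space (P r0). B r0 \<omega> \<inter> ball z \<rho> = {}}"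
          using \<rho>(2) by (intro finite_measure_mono) auto
        also have "\<dots> \<le> exp (- ?V * T) + c r0 * A \<rho> (\<rho> / 2) T"
        proof (rule dead_leaves_boundary_miss_probability[OF dl[OF r0] _ \<rho>(1) \<open>0 \<le> T\<close> core[OF r0] fin[OF r0] B[OF r0]])
          show "0 \<le> c r0 * A \<rho> (\<rho> / 2) T" using c(1)[OF r0] A by simp
        qed (use r0 a \<rho>(1) \<open>0 \<le> T\<close> in \<open>auto intro!: count\<close>)
        also have "c r0 * A \<rho> (\<rho> / 2) T \<le> 2 powr \<alpha> * r0 powr (\<alpha> - 1) * A \<rho> (\<rho> / 2) T"
          using power_law_constant_le[OF Q c(2)[OF r0] c(1)[OF r0] r0(1)] elim(1) \<alpha>(1) A
          by (intro mult_right_mono) auto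
        also have "\<dots> < e / 2" using elim by simp
        finally show ?case using void by simp
      qed
    qed
  qed
  with B show ?thesis by blast
qed

theorem proposition9:
  fixes \<alpha> a1 a2 :: real and r1 :: ereal
    and Q :: "'q measure" and Y :: "'q \<Rightarrow> (real^2) set" and R :: "real \<Rightarrow> 'q \<Rightarrow> real"
    and P :: "real \<Rightarrow> 'w measure"
    and x :: "real \<Rightarrow> nat \<Rightarrow> 'w \<Rightarrow> real^2"
    and t :: "real \<Rightarrow> nat \<Rightarrow> 'w \<Rightarrow> real"
    and L :: "real \<Rightarrow> nat \<Rightarrow> 'w \<Rightarrow> (real^2) set"
  assumes "(1 < \<alpha> \<and> \<alpha> \<le> 3 \<and> 0 < r1 \<and> r1 < \<infinity>) \<or> (3 < \<alpha> \<and> 0 < r1)"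
    and "prob_space Q"
    and "random_compact_set Q Y"
    and "0 < a1" and "a1 < a2"
    and "AE \<omega> in Q. cball 0 a1 \<subseteq> Y \<omega> \<and> Y \<omega> \<subseteq> cball 0 a2"
    and "\<And>r0. 0 < r0 \<Longrightarrow> ereal r0 < r1 \<Longrightarrow>
           power_law_radius Q \<alpha> r0 r1 (R r0) \<and>
           independent_rvs Q borel (R r0) (borel_of fell_topology) Y"
    and "\<And>r0. 0 < r0 \<Longrightarrow> ereal r0 < r1 \<Longrightarrow>
           dead_leaves_process (P r0)
             (distr Q (borel_of fell_topology) (scaled_set (R r0) Y)) (x r0) (t r0) (L r0)"
  shows "\<exists>B :: real \<Rightarrow> 'w \<Rightarrow> (real^2) set.
           (\<forall>r0. 0 < r0 \<and> ereal r0 < r1 \<longrightarrow>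
              random_closed_set (P r0) (B r0) \<and>
              (AE \<omega> in P r0. B r0 \<omega> = dead_leaves_boundary (x r0) (t r0) (L r0) \<omega>)) \<and>
           weakly_converges fell_topology
             (\<lambda>r0. distr (P r0) (borel_of fell_topology) (B r0))
             (return (borel_of fell_topology) UNIV) (at_right 0)"
proof (rule dead_leaves_boundary_converges)
  show "1 < \<alpha>" "real DIM(real^2) + 1 < \<alpha> \<or> r1 < \<infinity>" "0 < r1" using assms(1) by auto
  show "random_closed_set Q Y" using assms(3) by (simp add: random_compact_set_def)
qed (use assms in auto)

end
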